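(* Let $\mathcal K$ be a simplicial complex on the vertex set $[m]=\{1,\ldots,m\}$, and let $RC_{\mathcal K}$ be the corresponding right-angled Coxeter group with canonical generators $g_1,\ldots,g_m$. The commutator subgroup $RC_{\mathcal K}'$ has a finite minimal generator set consisting of $\sum_{J\subset[m]}\operatorname{rank}\widetilde H_0(\mathcal K_J)$ iterated commutators, namely all the commutators $$(g_{k_1},(g_{k_2},\cdots(g_{k_{\ell-2}},(g_j,g_i))\cdots)),\qquad 2\le \ell\le m$$ (for $\ell=2$ this is $(g_j,g_i)$, for $\ell=3$ it is $(g_{k_1},(g_j,g_i))$, and so on), where $k_1<k_2<\cdots<k_{\ell-2}<j>i$, $k_s\neq i$ for every $s$, and $i$ is the smallest vertex in a connected component not containing $j$ of the full subcomplex $\mathcal K_{\{k_1,\ldots,k_{\ell-2},j,i\}}$.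
   Context: A simplicial complex $\mathcal K$ on $[m]=\{1,\ldots,m\}$ is a collection of subsets of $[m]$ closed under taking subsets; it is always assumed that $\varnothing\in\mathcal K$ and $\{i\}\in\mathcal K$ for all $i\in[m]$. For $J\subset[m]$, the full subcomplex is $\mathcal K_J=\{I\in\mathcal K: I\subset J\}$, a simplicial complex on the vertex set $J$. $\widetilde H_0(\mathcal K_J)$ is the reduced simplicial homology group with integer coefficients; for $J\ne\varnothing$ its rank is the number of connected components of $\mathcal K_J$ minus one, and it is zero for $J=\varnothing$. The right-angled Coxeter group of $\mathcal K$ is $$RC_{\mathcal K}=F(g_1,\ldots,g_m)\big/\bigl(g_i^2=1 \text{ for } i=1,\ldots,m,\ \ g_ig_j=g_jg_i\text{ for }\{i,j\}\in\mathcal K\bigr),$$ where $F(g_1,\ldots,g_m)$ is the free group on $g_1,\ldots,g_m$. The group commutator is $(g,h)=g^{-1}h^{-1}gh$. The condition $k_1<\cdots<k_{\ell-2}<j>i$ means $k_1<\cdots<k_{\ell-2}<j$ and $i<j$ (with no order relation imposed between $i$ and the $k_s$). *)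

theory Defs
  imports
    "HOL-Algebra.Algebra"
    "HOL-Algebra.Free_Abelian_Groups"
    "HOL-Library.Extended_Nat"
begin

section \<open>Simplicial complexes\<close>

definition simplicial_complex_on :: "'a set \<Rightarrow> 'a set set \<Rightarrow> bool" where
  "simplicial_complex_on V K \<longleftrightarrow>
     (\<forall>I\<in>K. I \<subseteq> V) \<and> (\<forall>I\<in>K. \<forall>L. L \<subseteq> I \<longrightarrow> L \<in> K) \<and> {} \<in> K \<and> (\<forall>v\<in>V. {v} \<in> K)"

definition full_subcomplex :: "'a set set \<Rightarrow> 'a set \<Rightarrow> 'a set set" where
  "full_subcomplex K J = {I \<in> K. I \<subseteq> J}"

text \<open>A connected component is represented by its set of vertices.\<close>

definition connected_components :: "'a set set \<Rightarrow> 'a set set" where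
  "connected_components K =
     \<Union>K // ({(u, v). {u, v} \<in> K}\<^sup>* \<inter> \<Union>K \<times> \<Union>K)"

section \<open>Reduced simplicial homology\<close>

text \<open>
  The vertices are linearly ordered, and a simplex is oriented by listing its vertices in
  increasing order. Chain groups are indexed by the number \<open>q\<close> of vertices, so
  \<open>simplicial_chain_group q K\<close> is the usual group of chains of dimension \<open>q - 1\<close>. The value
  \<open>q = 0\<close> gives the copy of the integers spanned by the empty simplex, and the boundary of
  a vertex is the empty simplex, i.e. the boundary map on vertices is the augmentation.
\<close>

definition simplicial_chain_group :: "nat \<Rightarrow> 'a set set \<Rightarrow> ('a set \<Rightarrow>\<^sub>0 int) monoid" where
  "simplicial_chain_group q K = free_Abelian_group {I \<in> K. finite I \<and> card I = q}"

definition simplicial_boundary :: "('a::linorder set \<Rightarrow>\<^sub>0 int) \<Rightarrow> ('a set \<Rightarrow>\<^sub>0 int)" where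
  "simplicial_boundary =
     frag_extend (\<lambda>I. \<Sum>v\<in>I. frag_cmul ((- 1) ^ card {u \<in> I. u < v}) (frag_of (I - {v})))"

definition reduced_homology_group ::
    "nat \<Rightarrow> 'a::linorder set set \<Rightarrow> ('a set \<Rightarrow>\<^sub>0 int) set monoid" where
  "reduced_homology_group p K =
     subgroup_generated (simplicial_chain_group (p + 1) K)
       (kernel (simplicial_chain_group (p + 1) K) (simplicial_chain_group p K) simplicial_boundary)
     Mod (simplicial_boundary ` carrier (simplicial_chain_group (p + 2) K))"

text \<open>The rank of an abelian group: the supremum of the sizes of its finite
  \<open>\<int>\<close>-linearly independent subsets.\<close>

definition int_independent :: "('a, 'b) monoid_scheme \<Rightarrow> 'a set \<Rightarrow> bool" where
  "int_independent G B \<longleftrightarrow>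
     (\<forall>c :: 'a \<Rightarrow> int. (\<Otimes>\<^bsub>G\<^esub>b\<in>B. b [^]\<^bsub>G\<^esub> c b) = \<one>\<^bsub>G\<^esub> \<longrightarrow> (\<forall>b\<in>B. c b = 0))"

definition abelian_rank :: "('a, 'b) monoid_scheme \<Rightarrow> enat" where
  "abelian_rank G = (SUP B\<in>{B. finite B \<and> B \<subseteq> carrier G \<and> int_independent G B}. enat (card B))"

section \<open>Free groups and presentations\<close>

text \<open>
  Elements of the free group are the reduced words in the letters \<open>(x, True)\<close>, standing
  for the generator \<open>x\<close>, and \<open>(x, False)\<close>, standing for its inverse. The product of two
  reduced words is their concatenation followed by free reduction, carried out by pushing the
  letters of the first word one by one onto the second.
\<close>

type_synonym 'a word = "('a \<times> bool) list"

definition reduced_word :: "'a word \<Rightarrow> bool" where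
  "reduced_word = successively (\<lambda>(x, a) (y, b). \<not> (x = y \<and> a \<noteq> b))"

fun push_letter :: "'a \<times> bool \<Rightarrow> 'a word \<Rightarrow> 'a word" where
  "push_letter (x, a) [] = [(x, a)]"
| "push_letter (x, a) ((y, b) # w) = (if x = y \<and> a \<noteq> b then w else (x, a) # (y, b) # w)"

definition free_group :: "'a set \<Rightarrow> 'a word monoid" where
  "free_group S =
     \<lparr>carrier = {w. reduced_word w \<and> fst ` set w \<subseteq> S},
      monoid.mult = foldr push_letter,
      one = []\<rparr>"

definition free_gen :: "'a \<Rightarrow> 'a word" where
  "free_gen x = [(x, True)]"

definition normal_closure :: "('a, 'b) monoid_scheme \<Rightarrow> 'a set \<Rightarrow> 'a set" where
  "normal_closure G R = \<Inter>{N. N \<lhd> G \<and> R \<subseteq> N}"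

text \<open>A relation \<open>u = v\<close> is given by the pair \<open>(u, v)\<close> of elements of the free group.\<close>

definition relation_subgroup :: "'a set \<Rightarrow> ('a word \<times> 'a word) set \<Rightarrow> 'a word set" where
  "relation_subgroup S E =
     normal_closure (free_group S)
       {u \<otimes>\<^bsub>free_group S\<^esub> inv\<^bsub>free_group S\<^esub> v | u v. (u, v) \<in> E}"

definition presented_group :: "'a set \<Rightarrow> ('a word \<times> 'a word) set \<Rightarrow> 'a word set monoid" where
  "presented_group S E = free_group S Mod relation_subgroup S E"

definition presented_gen :: "'a set \<Rightarrow> ('a word \<times> 'a word) set \<Rightarrow> 'a \<Rightarrow> 'a word set" where
  "presented_gen S E x = relation_subgroup S E #>\<^bsub>free_group S\<^esub> free_gen x"

section \<open>Right-angled Coxeter groups\<close>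

definition RC_relations :: "'a set \<Rightarrow> 'a set set \<Rightarrow> ('a word \<times> 'a word) set" where
  "RC_relations V K =
     {(free_gen i \<otimes>\<^bsub>free_group V\<^esub> free_gen i, \<one>\<^bsub>free_group V\<^esub>) | i. i \<in> V} \<union>
     {(free_gen i \<otimes>\<^bsub>free_group V\<^esub> free_gen j, free_gen j \<otimes>\<^bsub>free_group V\<^esub> free_gen i) | i j.
        {i, j} \<in> K}"

definition RC :: "'a set \<Rightarrow> 'a set set \<Rightarrow> 'a word set monoid" where
  "RC V K = presented_group V (RC_relations V K)"

definition RC_gen :: "'a set \<Rightarrow> 'a set set \<Rightarrow> 'a \<Rightarrow> 'a word set" where
  "RC_gen V K i = presented_gen V (RC_relations V K) i"

section \<open>Commutators and generating sets\<close>

definition commutator :: "('a, 'b) monoid_scheme \<Rightarrow> 'a \<Rightarrow> 'a \<Rightarrow> 'a" where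
  "commutator G g h = inv\<^bsub>G\<^esub> g \<otimes>\<^bsub>G\<^esub> inv\<^bsub>G\<^esub> h \<otimes>\<^bsub>G\<^esub> g \<otimes>\<^bsub>G\<^esub> h"

text \<open>For \<open>ks = [k\<^sub>1, \<dots>, k\<^sub>n]\<close> this is
  \<open>(g\<^sub>k\<^sub>1, (g\<^sub>k\<^sub>2, \<dots> (g\<^sub>k\<^sub>n, (g\<^sub>j, g\<^sub>i)) \<dots>))\<close>.\<close>

definition iterated_commutator ::
    "('a, 'b) monoid_scheme \<Rightarrow> ('i \<Rightarrow> 'a) \<Rightarrow> 'i list \<Rightarrow> 'i \<Rightarrow> 'i \<Rightarrow> 'a" where
  "iterated_commutator G g ks j i =
     foldr (\<lambda>k c. commutator G (g k) c) ks (commutator G (g j) (g i))"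

definition generates :: "('a, 'b) monoid_scheme \<Rightarrow> 'a set \<Rightarrow> 'a set \<Rightarrow> bool" where
  "generates G H T \<longleftrightarrow> T \<subseteq> H \<and> generate G T = H"

text \<open>
  A finite generator set of \<open>H\<close> is minimal if no generator set of \<open>H\<close> has fewer elements.
  For finite sets this implies irredundancy, which is stated as well.
\<close>

definition finite_minimal_generator_set ::
    "('a, 'b) monoid_scheme \<Rightarrow> 'a set \<Rightarrow> 'a set \<Rightarrow> bool" where
  "finite_minimal_generator_set G H T \<longleftrightarrow>
     finite T \<and> generates G H T \<and>
     (\<forall>T'. T' \<subset> T \<longrightarrow> \<not> generates G H T') \<and>
     (\<forall>T'. finite T' \<and> generates G H T' \<longrightarrow> card T \<le> card T')"

end

theory Submission
  imports Defs
begin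

text \<open>
  For \<open>A \<subseteq> [m]\<close> let \<open>w\<^sub>A\<close> be the product of the \<open>g\<^sub>a\<close>, \<open>a \<in> A\<close>, in increasing order. The \<open>w\<^sub>A\<close> form a
  transversal of the commutator subgroup, which is therefore generated by the Schreier generators
  \<open>s\<^sub>J\<^sub>,\<^sub>i = w\<^sub>J\<^sub>-\<^sub>i g\<^sub>i w\<^sub>J\<^sup>-\<^sup>1\<close>, \<open>i \<in> J\<close>. If \<open>j = max J\<close>, then \<open>s\<^sub>J\<^sub>,\<^sub>j = 1\<close>, and for \<open>i \<noteq> j\<close> the element
  \<open>s\<^sub>J\<^sub>,\<^sub>i\<close> is the product of a conjugate \<open>w\<^sub>B (g\<^sub>j, g\<^sub>i) w\<^sub>B\<^sup>-\<^sup>1\<close>, \<open>B = J - {i, j}\<close>, and \<open>s\<^sub>J\<^sub>-\<^sub>j\<^sub>,\<^sub>i\<close>. An edge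
  \<open>{i, i'}\<close> of \<open>K\<^sub>J\<close> gives \<open>s\<^sub>J\<^sub>-\<^sub>i\<^sub>'\<^sub>,\<^sub>i s\<^sub>J\<^sub>,\<^sub>i\<^sub>' = s\<^sub>J\<^sub>-\<^sub>i\<^sub>,\<^sub>i\<^sub>' s\<^sub>J\<^sub>,\<^sub>i\<close>, so modulo smaller \<open>J\<close> the generator
  depends only on the component of \<open>i\<close>, and only the minima of the components without \<open>max J\<close>
  are needed. Conjugates by \<open>w\<^sub>B\<close> and iterated commutators with the \<open>g\<^sub>k\<close>, \<open>k \<in> B\<close>, generate the same
  subgroup, because the condition on \<open>(B, j, i)\<close> is inherited by subsets of \<open>B\<close>.

  For minimality, a locally constant function \<open>f\<close> on \<open>K\<^sub>J\<close> defines a homomorphism to the infinite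
  dihedral group that sends \<open>g\<^sub>k\<close> to the reflection \<open>x \<mapsto> f k - x\<close> if \<open>k \<in> J\<close> and to \<open>1\<close> otherwise. It maps
  the commutator subgroup to translations, and an iterated commutator of length \<open>\<ell>\<close> on the vertex
  set \<open>J'\<close> to \<open>\<plusminus>2\<^sup>\<ell>\<^sup>-\<^sup>1 (f j - f i)\<close> if \<open>J' \<subseteq> J\<close> and to \<open>0\<close> otherwise. With \<open>f\<close> the indicator function of a
  component, these values form a triangular matrix with respect to \<open>card J\<close>, so no generating set
  can have fewer elements.
\<close>

section \<open>Free groups and presentations\<close>

definition inv_letter :: "'a \<times> bool \<Rightarrow> 'a \<times> bool" where
  "inv_letter l = (fst l, \<not> snd l)"

lemma inv_letter_inv_letter [simp]: "inv_letter (inv_letter l) = l"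
  by (simp add: inv_letter_def)

lemma fst_inv_letter [simp]: "fst (inv_letter l) = fst l"
  by (simp add: inv_letter_def)

lemma push_letter_Cons:
  "push_letter l (k # w) = (if k = inv_letter l then w else l # k # w)"
  by (cases l; cases k) (auto simp: inv_letter_def)

lemma push_letter_Nil: "push_letter l [] = [l]"
  by (cases l) auto

lemma reduced_word_Cons_Cons:
  "reduced_word (l # k # w) \<longleftrightarrow> k \<noteq> inv_letter l \<and> reduced_word (k # w)"
  by (cases l; cases k) (auto simp: reduced_word_def inv_letter_def)

lemma reduced_word_tl: "reduced_word (l # w) \<Longrightarrow> reduced_word w"
  by (cases w) (auto simp: reduced_word_Cons_Cons reduced_word_def)

lemma reduced_word_Nil [simp]: "reduced_word []"
  by (simp add: reduced_word_def)

lemma reduced_word_single [simp]: "reduced_word [l]"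
  by (simp add: reduced_word_def)

lemma reduced_push_letter: "reduced_word w \<Longrightarrow> reduced_word (push_letter l w)"
  by (cases w) (auto simp: push_letter_Nil push_letter_Cons reduced_word_Cons_Cons
      dest: reduced_word_tl)

lemma push_letter_reduced: "reduced_word (l # w) \<Longrightarrow> push_letter l w = l # w"
  by (cases w) (auto simp: push_letter_Nil push_letter_Cons reduced_word_Cons_Cons)

lemma push_letter_inv_letter: "reduced_word w \<Longrightarrow> push_letter l (push_letter (inv_letter l) w) = w"
  by (cases w) (auto simp: push_letter_Nil push_letter_Cons push_letter_reduced)

lemma set_push_letter: "set (push_letter l w) \<subseteq> insert l (set w)"
  by (cases w) (auto simp: push_letter_Nil push_letter_Cons)

lemma reduced_foldr_push: "reduced_word w \<Longrightarrow> reduced_word (foldr push_letter u w)"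
  by (induction u) (auto simp: reduced_push_letter)

lemma set_foldr_push: "set (foldr push_letter u w) \<subseteq> set u \<union> set w"
  using set_push_letter by (induction u) fastforce+

lemma fst_set_foldr_push:
  assumes "fst ` set u \<subseteq> S" "fst ` set w \<subseteq> S"
  shows "fst ` set (foldr push_letter u w) \<subseteq> S"
  by (rule order_trans[OF image_mono[OF set_foldr_push]]) (use assms in auto)

text \<open>Associativity for a single letter. If \<open>l\<close> cancels the head of
  \<open>v\<close>, that head is \<open>inv_letter l\<close>, and pushing \<open>l\<close> on the
  right-hand side undoes its push; this is where \<open>w\<close> must be reduced.\<close>

lemma foldr_push_push:
  assumes "reduced_word w"
  shows "foldr push_letter (push_letter l v) w = push_letter l (foldr push_letter v w)"
proof (cases v)
  case (Cons k v')
  show ?thesis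
  proof (cases "k = inv_letter l")
    case True
    then show ?thesis
      using push_letter_inv_letter[OF reduced_foldr_push[OF assms]] Cons
      by (simp add: push_letter_Cons)
  qed (simp add: Cons push_letter_Cons)
qed (simp add: push_letter_Nil)

lemma foldr_push_assoc:
  assumes "reduced_word w"
  shows "foldr push_letter (foldr push_letter u v) w = foldr push_letter u (foldr push_letter v w)"
  by (induction u) (simp_all add: foldr_push_push assms)

lemma foldr_push_inv_word:
  "reduced_word w \<Longrightarrow> foldr push_letter (map inv_letter (rev w)) w = []"
proof (induction w)
  case (Cons l w)
  have "push_letter (inv_letter l) (l # w) = w"
    by (simp add: push_letter_Cons)
  then show ?case
    using Cons.IH reduced_word_tl[OF Cons.prems] by simp
qed simp

lemma group_free_group: "group (free_group S)"
proof (rule groupI)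
  fix w assume w: "w \<in> carrier (free_group S)"
  \<comment> \<open>Pushing the formal inverse onto \<open>[]\<close> makes the candidate reduced by
    construction.\<close>
  let ?v = "foldr push_letter (map inv_letter (rev w)) []"
  have "fst ` set ?v \<subseteq> S"
    by (rule fst_set_foldr_push) (use w in \<open>auto simp: free_group_def\<close>)
  then have "?v \<in> carrier (free_group S)"
    by (simp add: free_group_def reduced_foldr_push)
  moreover have "?v \<otimes>\<^bsub>free_group S\<^esub> w = \<one>\<^bsub>free_group S\<^esub>"
    using w by (simp add: free_group_def foldr_push_assoc foldr_push_inv_word)
  ultimately show "\<exists>v\<in>carrier (free_group S). v \<otimes>\<^bsub>free_group S\<^esub> w = \<one>\<^bsub>free_group S\<^esub>"
    by blast
next
  fix u v assume "u \<in> carrier (free_group S)" "v \<in> carrier (free_group S)"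
  then show "u \<otimes>\<^bsub>free_group S\<^esub> v \<in> carrier (free_group S)"
    by (simp add: free_group_def reduced_foldr_push fst_set_foldr_push)
qed (auto simp: free_group_def foldr_push_assoc)

lemma free_gen_closed [simp]: "x \<in> S \<Longrightarrow> free_gen x \<in> carrier (free_group S)"
  by (simp add: free_group_def free_gen_def)

lemma inv_free_gen: "x \<in> S \<Longrightarrow> inv\<^bsub>free_group S\<^esub> (free_gen x) = [(x, False)]"
  by (rule group.inv_equality[OF group_free_group]) (auto simp: free_group_def free_gen_def)

lemma carrier_free_group_generate: "carrier (free_group S) = generate (free_group S) (free_gen ` S)"
proof
  interpret group "free_group S" by (rule group_free_group)
  show "generate (free_group S) (free_gen ` S) \<subseteq> carrier (free_group S)"
    by (rule generate_incl) auto
  show "carrier (free_group S) \<subseteq> generate (free_group S) (free_gen ` S)"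
  proof
    fix w assume "w \<in> carrier (free_group S)"
    then show "w \<in> generate (free_group S) (free_gen ` S)"
    proof (induction w)
      case Nil
      then show ?case
        using generate.one[of "free_group S"] by (simp add: free_group_def)
    next
      case (Cons l w)
      then have w: "w \<in> generate (free_group S) (free_gen ` S)" and l: "fst l \<in> S"
        by (auto simp: free_group_def dest: reduced_word_tl)
      have "[l] \<in> generate (free_group S) (free_gen ` S)"
        using l generate.incl[of "free_gen (fst l)" "free_gen ` S" "free_group S"]
          generate.inv[of "free_gen (fst l)" "free_gen ` S" "free_group S"]
        by (cases l; cases "snd l") (auto simp: inv_free_gen, auto simp: free_gen_def)
      moreover have "[l] \<otimes>\<^bsub>free_group S\<^esub> w = l # w"
        using Cons.prems by (simp add: free_group_def push_letter_reduced)
      ultimately show ?case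
        using w by (metis generate.eng)
    qed
  qed
qed

section \<open>Universal property of the free group\<close>

definition word_lift :: "('b, 'c) monoid_scheme \<Rightarrow> ('a \<Rightarrow> 'b) \<Rightarrow> 'a word \<Rightarrow> 'b" where
  "word_lift H f w =
     foldr (\<lambda>l y. (if snd l then f (fst l) else inv\<^bsub>H\<^esub> f (fst l)) \<otimes>\<^bsub>H\<^esub> y) w \<one>\<^bsub>H\<^esub>"

text \<open>Evaluation respects free reduction: pushing a letter multiplies the value by that of the
  letter, whether it cancels or not. Multiplicativity follows by induction on the left word.\<close>

lemma word_lift_hom:
  assumes "group H" "f \<in> S \<rightarrow> carrier H"
  shows "word_lift H f \<in> hom (free_group S) H"
proof -
  interpret group H by fact
  have [simp]: "f x \<in> carrier H" if "x \<in> S" for x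
    using that assms by auto
  have Cons_eq: "word_lift H f (l # w) =
      (if snd l then f (fst l) else inv\<^bsub>H\<^esub> f (fst l)) \<otimes>\<^bsub>H\<^esub> word_lift H f w" for l w
    by (simp add: word_lift_def)
  have cl: "word_lift H f w \<in> carrier H" if "fst ` set w \<subseteq> S" for w
    using that by (induction w) (auto simp: Cons_eq, auto simp: word_lift_def)
  have push: "word_lift H f (push_letter l w) = word_lift H f (l # w)"
    if "fst ` set (l # w) \<subseteq> S" for l w
    using that cl by (cases w) (auto simp: push_letter_Nil push_letter_Cons Cons_eq inv_letter_def m_assoc[symmetric])
  have "word_lift H f (foldr push_letter u v) = word_lift H f u \<otimes>\<^bsub>H\<^esub> word_lift H f v"
    if "fst ` set u \<subseteq> S" "fst ` set v \<subseteq> S" for u v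
    using that(1)
  proof (induction u)
    case Nil
    then show ?case
      using cl[OF that(2)] by (simp add: word_lift_def)
  next
    case (Cons l u)
    have "fst ` set (foldr push_letter u v) \<subseteq> S"
      using Cons.prems that(2) by (intro fst_set_foldr_push) auto
    then have "word_lift H f (foldr push_letter (l # u) v) =
        word_lift H f (l # foldr push_letter u v)"
      using Cons.prems by (simp add: push)
    then show ?case
      using Cons cl that(2) by (auto simp: Cons_eq m_assoc)
  qed
  then show ?thesis
    using cl by (auto simp: hom_def free_group_def)
qed

section \<open>Normal closures and presented groups\<close>

lemma normal_closure_normal:
  assumes "group G" "R \<subseteq> carrier G"
  shows "normal_closure G R \<lhd> G"
proof -
  interpret group G by fact
  \<comment> \<open>The family being intersected is nonempty, so its intersection is a
    subgroup.\<close>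
  have *: "carrier G \<in> {N. N \<lhd> G \<and> R \<subseteq> N}"
    using assms normal_self by auto
  show ?thesis
  proof (subst normal_inv_iff, unfold normal_closure_def, intro conjI ballI)
    show "subgroup (\<Inter> {N. N \<lhd> G \<and> R \<subseteq> N}) G"
      by (rule subgroups_Inter) (use * normal_imp_subgroup in auto)
  qed (auto simp: normal_inv_iff)
qed

lemma normal_closure_superset: "R \<subseteq> normal_closure G R"
  by (auto simp: normal_closure_def)

lemma normal_closure_minimal: "N \<lhd> G \<Longrightarrow> R \<subseteq> N \<Longrightarrow> normal_closure G R \<subseteq> N"
  by (auto simp: normal_closure_def)

context
  fixes S :: "'a set" and E :: "('a word \<times> 'a word) set"
  assumes E: "E \<subseteq> carrier (free_group S) \<times> carrier (free_group S)"
begin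

interpretation F: group "free_group S"
  by (rule group_free_group)

lemma relation_subgroup_normal: "relation_subgroup S E \<lhd> free_group S"
  unfolding relation_subgroup_def
  by (rule normal_closure_normal) (use E in \<open>auto intro: F.is_group\<close>)

interpretation N: normal "relation_subgroup S E" "free_group S"
  by (rule relation_subgroup_normal)

lemma group_presented_group: "group (presented_group S E)"
  unfolding presented_group_def by (rule N.factorgroup_is_group)

lemma presented_proj_hom:
  "r_coset (free_group S) (relation_subgroup S E) \<in> hom (free_group S) (presented_group S E)"
  unfolding presented_group_def by (rule N.r_coset_hom_Mod)

lemma presented_proj_eq:
  assumes "(u, v) \<in> E"
  shows "relation_subgroup S E #>\<^bsub>free_group S\<^esub> u = relation_subgroup S E #>\<^bsub>free_group S\<^esub> v"
proof -
  have uv: "u \<in> carrier (free_group S)" "v \<in> carrier (free_group S)"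
    using assms E by auto
  have "u \<otimes>\<^bsub>free_group S\<^esub> inv\<^bsub>free_group S\<^esub> v \<in> relation_subgroup S E"
    unfolding relation_subgroup_def using assms normal_closure_superset by fast
  then have "u \<in> relation_subgroup S E #>\<^bsub>free_group S\<^esub> v"
    using uv by (force simp: r_coset_def F.m_assoc)
  then show ?thesis
    using F.repr_independence[OF _ uv(2) N.is_subgroup] by blast
qed

lemma presented_gen_closed: "x \<in> S \<Longrightarrow> presented_gen S E x \<in> carrier (presented_group S E)"
  using hom_in_carrier[OF presented_proj_hom] by (simp add: presented_gen_def)

lemma carrier_presented_group_generate:
  "carrier (presented_group S E) = generate (presented_group S E) (presented_gen S E ` S)"
proof -
  interpret h: group_hom "free_group S" "presented_group S E"
    "r_coset (free_group S) (relation_subgroup S E)"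
    using group_presented_group presented_proj_hom
    by (simp add: group_hom_def group_hom_axioms_def F.is_group)
  have "carrier (presented_group S E) =
      r_coset (free_group S) (relation_subgroup S E) ` generate (free_group S) (free_gen ` S)"
    by (simp add: presented_group_def carrier_FactGroup flip: carrier_free_group_generate)
  also have "\<dots> = generate (presented_group S E)
      (r_coset (free_group S) (relation_subgroup S E) ` free_gen ` S)"
    by (rule h.generate_img[symmetric]) auto
  finally show ?thesis
    by (simp add: presented_gen_def image_image)
qed

text \<open>The kernel of \<open>word_lift H f\<close> is normal and contains all relators, hence
  their normal closure, so the map factors through the quotient.\<close>

lemma presented_group_universal:
  assumes "group H" "f \<in> S \<rightarrow> carrier H"
    and "\<And>u v. (u, v) \<in> E \<Longrightarrow> word_lift H f u = word_lift H f v"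
  obtains h where "h \<in> hom (presented_group S E) H" "\<And>x. x \<in> S \<Longrightarrow> h (presented_gen S E x) = f x"
proof -
  interpret H: group H by fact
  interpret l: group_hom "free_group S" H "word_lift H f"
    using word_lift_hom[OF assms(1,2)] by (simp add: group_hom_def group_hom_axioms_def assms F.is_group)
  have "relation_subgroup S E \<subseteq> kernel (free_group S) H (word_lift H f)"
    unfolding relation_subgroup_def
  proof (rule normal_closure_minimal[OF l.normal_kernel], safe)
    fix u v assume "(u, v) \<in> E"
    then show "u \<otimes>\<^bsub>free_group S\<^esub> inv\<^bsub>free_group S\<^esub> v \<in> kernel (free_group S) H (word_lift H f)"
      using E assms(3) by (auto simp: kernel_def)
  qed
  then obtain h where h: "h \<in> hom (free_group S Mod relation_subgroup S E) H"
    "\<And>w. w \<in> carrier (free_group S) \<Longrightarrow> h (relation_subgroup S E #>\<^bsub>free_group S\<^esub> w) = word_lift H f w"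
    using l.FactGroup_universal_kernel[OF relation_subgroup_normal] by metis
  show thesis
  proof (rule that)
    show "h \<in> hom (presented_group S E) H"
      using h(1) by (simp add: presented_group_def)
    show "h (presented_gen S E x) = f x" if "x \<in> S" for x
    proof -
      have "h (presented_gen S E x) = word_lift H f (free_gen x)"
        using that h(2) by (simp add: presented_gen_def)
      then show ?thesis
        using that assms(2) by (simp add: word_lift_def free_gen_def Pi_iff)
    qed
  qed
qed

end

section \<open>Right-angled Coxeter groups\<close>

lemma word_lift_free_gen:
  "group H \<Longrightarrow> f x \<in> carrier H \<Longrightarrow> word_lift H f (free_gen x) = f x"
  by (simp add: word_lift_def free_gen_def monoid.r_one[OF group.is_monoid])

lemma simplicial_complex_edgeD:
  assumes "simplicial_complex_on V K" "{i, j} \<in> K"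
  shows "i \<in> V" "j \<in> V"
  using assms by (auto simp: simplicial_complex_on_def)

context
  fixes V :: "'i set" and K :: "'i set set"
  assumes K: "simplicial_complex_on V K"
begin

interpretation F: group "free_group V"
  by (rule group_free_group)

lemma RC_relations_carrier: "RC_relations V K \<subseteq> carrier (free_group V) \<times> carrier (free_group V)"
  using simplicial_complex_edgeD[OF K] by (auto simp: RC_relations_def)

lemma group_RC: "group (RC V K)"
  unfolding RC_def by (rule group_presented_group[OF RC_relations_carrier])

lemma RC_gen_closed: "i \<in> V \<Longrightarrow> RC_gen V K i \<in> carrier (RC V K)"
  unfolding RC_def RC_gen_def by (rule presented_gen_closed[OF RC_relations_carrier])

lemma RC_gen_mult:
  assumes "i \<in> V" "j \<in> V"
  shows "RC_gen V K i \<otimes>\<^bsub>RC V K\<^esub> RC_gen V K j =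
    relation_subgroup V (RC_relations V K) #>\<^bsub>free_group V\<^esub> (free_gen i \<otimes>\<^bsub>free_group V\<^esub> free_gen j)"
  using hom_mult[OF presented_proj_hom[OF RC_relations_carrier], of "free_gen i" "free_gen j"] assms
  by (simp add: RC_def RC_gen_def presented_gen_def)

lemma RC_gen_square:
  assumes "i \<in> V"
  shows "RC_gen V K i \<otimes>\<^bsub>RC V K\<^esub> RC_gen V K i = \<one>\<^bsub>RC V K\<^esub>"
proof -
  have "(free_gen i \<otimes>\<^bsub>free_group V\<^esub> free_gen i, \<one>\<^bsub>free_group V\<^esub>) \<in> RC_relations V K"
    using assms by (auto simp: RC_relations_def)
  then have "RC_gen V K i \<otimes>\<^bsub>RC V K\<^esub> RC_gen V K i =
      relation_subgroup V (RC_relations V K) #>\<^bsub>free_group V\<^esub> \<one>\<^bsub>free_group V\<^esub>"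
    using presented_proj_eq[OF RC_relations_carrier] RC_gen_mult[OF assms assms] by simp
  also have "\<dots> = \<one>\<^bsub>RC V K\<^esub>"
    using hom_one[OF presented_proj_hom[OF RC_relations_carrier] F.is_group group_presented_group[OF RC_relations_carrier]]
    by (simp add: RC_def)
  finally show ?thesis .
qed

lemma RC_gen_commute:
  assumes "{i, j} \<in> K"
  shows "RC_gen V K i \<otimes>\<^bsub>RC V K\<^esub> RC_gen V K j = RC_gen V K j \<otimes>\<^bsub>RC V K\<^esub> RC_gen V K i"
proof -
  have "(free_gen i \<otimes>\<^bsub>free_group V\<^esub> free_gen j, free_gen j \<otimes>\<^bsub>free_group V\<^esub> free_gen i) \<in> RC_relations V K"
    using assms by (auto simp: RC_relations_def)
  then show ?thesis
    using presented_proj_eq[OF RC_relations_carrier] simplicial_complex_edgeD[OF K assms]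
    by (simp add: RC_gen_mult)
qed

lemma carrier_RC_generate: "carrier (RC V K) = generate (RC V K) (RC_gen V K ` V)"
  unfolding RC_def RC_gen_def by (rule carrier_presented_group_generate[OF RC_relations_carrier])

text \<open>The source of all homomorphisms to the infinite dihedral group: prescribed images of the
  generators only have to satisfy the Coxeter relations.\<close>

lemma RC_universal:
  assumes H: "group H" and f: "\<And>i. i \<in> V \<Longrightarrow> f i \<in> carrier H"
    and square: "\<And>i. i \<in> V \<Longrightarrow> f i \<otimes>\<^bsub>H\<^esub> f i = \<one>\<^bsub>H\<^esub>"
    and commute: "\<And>i j. {i, j} \<in> K \<Longrightarrow> f i \<otimes>\<^bsub>H\<^esub> f j = f j \<otimes>\<^bsub>H\<^esub> f i"
  obtains h where "h \<in> hom (RC V K) H" "\<And>i. i \<in> V \<Longrightarrow> h (RC_gen V K i) = f i"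
proof -
  have hom: "word_lift H f \<in> hom (free_group V) H"
    using f by (intro word_lift_hom[OF H]) auto
  have gen: "word_lift H f (free_gen i) = f i" if "i \<in> V" for i
    using that f by (simp add: word_lift_free_gen H)
  have "word_lift H f u = word_lift H f v" if "(u, v) \<in> RC_relations V K" for u v
    using that square commute simplicial_complex_edgeD[OF K] hom_one[OF hom F.is_group H]
    by (auto simp: RC_relations_def hom_mult[OF hom] gen)
  then show thesis
    using presented_group_universal[OF RC_relations_carrier H, of f] f that
    unfolding RC_def RC_gen_def by blast
qed

end

section \<open>Components of full subcomplexes\<close>

text \<open>Being a reflexive closure on the whole type, the relation also relates each point
  outside \<open>J\<close> to itself, so membership in \<open>J\<close> is imposed separately where
  it matters.\<close>

definition same_component :: "'i set set \<Rightarrow> 'i set \<Rightarrow> ('i \<times> 'i) set" where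
  "same_component K J = {(u, v). {u, v} \<in> full_subcomplex K J}\<^sup>*"

lemma same_component_refl [simp]: "(u, u) \<in> same_component K J"
  by (simp add: same_component_def)

lemma same_component_sym: "(u, v) \<in> same_component K J \<Longrightarrow> (v, u) \<in> same_component K J"
  unfolding same_component_def
  by (rule symD[OF sym_rtrancl]) (auto simp: sym_def insert_commute)

lemma same_component_trans:
  "(u, v) \<in> same_component K J \<Longrightarrow> (v, w) \<in> same_component K J \<Longrightarrow> (u, w) \<in> same_component K J"
  unfolding same_component_def by (rule rtrancl_trans)

lemma same_component_mono: "J \<subseteq> J' \<Longrightarrow> same_component K J \<subseteq> same_component K J'"
  unfolding same_component_def by (rule rtrancl_mono) (auto simp: full_subcomplex_def)

lemma same_component_in: "(u, v) \<in> same_component K J \<Longrightarrow> u \<in> J \<Longrightarrow> v \<in> J"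
  unfolding same_component_def by (induction rule: rtrancl_induct) (auto simp: full_subcomplex_def)

text \<open>
  One vertex for each component of \<open>K\<^sub>J\<close> that does not contain \<open>Max J\<close>. The unspecified value
  \<open>Max {}\<close> is harmless, since the set is empty for \<open>J = {}\<close>.
\<close>

definition component_minima :: "'i::linorder set set \<Rightarrow> 'i set \<Rightarrow> 'i set" where
  "component_minima K J =
     {i \<in> J. (i, Max J) \<notin> same_component K J \<and> (\<forall>v. (i, v) \<in> same_component K J \<longrightarrow> i \<le> v)}"

lemma component_minima_less_Max: "finite J \<Longrightarrow> i \<in> component_minima K J \<Longrightarrow> i < Max J"
  using Max_ge[of J i] by (fastforce simp: component_minima_def order.order_iff_strict)

text \<open>The least vertex of the component of \<open>v\<close> serves; the component lies in
  \<open>J\<close> and is therefore finite.\<close>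

lemma component_minimum_exists:
  assumes "finite J" "v \<in> J" "(v, Max J) \<notin> same_component K J"
  obtains i where "i \<in> component_minima K J" "(i, v) \<in> same_component K J"
proof
  let ?C = "{u. (v, u) \<in> same_component K J}"
  have "?C \<subseteq> J"
    using assms(2) same_component_in by fastforce
  then have fin: "finite ?C"
    using assms(1) finite_subset by blast
  then have Min: "Min ?C \<in> ?C"
    using same_component_refl[of v] by (intro Min_in) blast+
  then show "(Min ?C, v) \<in> same_component K J"
    using same_component_sym by auto
  have "(v, u) \<in> same_component K J" if "(Min ?C, u) \<in> same_component K J" for u
    using Min that same_component_trans by fast
  then show "Min ?C \<in> component_minima K J"
    using Min fin \<open>?C \<subseteq> J\<close> assms(3) unfolding component_minima_def by auto
qed

text \<open>Removing vertices can only split components, so \<open>i\<close> stays separated from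
  the maximum and stays least in its component. This heredity lets conjugates be replaced by
  iterated commutators.\<close>

lemma component_minima_subset:
  assumes "i \<in> component_minima K J" "J' \<subseteq> J" "i \<in> J'" "Max J' = Max J"
  shows "i \<in> component_minima K J'"
  using assms same_component_mono[of J' J K] by (auto simp: component_minima_def)

section \<open>Generators of the commutator subgroup\<close>

lemma sorted_list_of_set_insert_greater:
  assumes "finite A" "\<And>a. a \<in> A \<Longrightarrow> a < j"
  shows "sorted_list_of_set (insert j A) = sorted_list_of_set A @ [j]"
proof -
  have "j \<notin> A"
    using assms(2) by blast
  then have "sorted_wrt (<) (sorted_list_of_set A @ [j]) \<and> set (sorted_list_of_set A @ [j]) = insert j A \<and>
      length (sorted_list_of_set A @ [j]) = card (insert j A)"
    using assms by (auto simp: sorted_wrt_append)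
  then show ?thesis
    using assms(1) by (subst sorted_list_of_set_unique[symmetric]) auto
qed

lemma sorted_list_of_set_set:
  assumes "sorted_wrt (<) ks"
  shows "sorted_list_of_set (set ks) = ks"
  using assms by (simp add: strict_sorted_iff sorted_list_of_set.idem_if_sorted_distinct)

lemma sorted_wrt_subseqs:
  "sorted_wrt P ks \<Longrightarrow> ls \<in> set (subseqs ks) \<Longrightarrow> sorted_wrt P ls"
proof (induction ks arbitrary: ls)
  case (Cons k ks)
  show ?case
  proof (cases "ls \<in> set (subseqs ks)")
    case True
    then show ?thesis
      using Cons.IH Cons.prems(1) by simp
  next
    case False
    then obtain ls' where ls': "ls = k # ls'" "ls' \<in> set (subseqs ks)"
      using Cons.prems(2) by (auto simp: Let_def)
    moreover have "set ls' \<in> Pow (set ks)"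
      unfolding subseqs_powset[symmetric] using ls'(2) by (rule imageI)
    ultimately show ?thesis
      using Cons.IH Cons.prems(1) by auto
  qed
qed simp

context group
begin

lemma inv_mult_cancel:
  "x \<in> carrier G \<Longrightarrow> y \<in> carrier G \<Longrightarrow> inv x \<otimes> (x \<otimes> y) = y"
  "x \<in> carrier G \<Longrightarrow> y \<in> carrier G \<Longrightarrow> x \<otimes> (inv x \<otimes> y) = y"
  by (simp_all flip: m_assoc)

lemma commutator_closed:
  "x \<in> carrier G \<Longrightarrow> y \<in> carrier G \<Longrightarrow> commutator G x y \<in> carrier G"
  by (simp add: commutator_def)

lemma commutator_in_derived:
  assumes "x \<in> carrier G" "y \<in> carrier G"
  shows "commutator G x y \<in> derived G (carrier G)"
  unfolding derived_def
proof (rule generate.incl)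
  \<comment> \<open>\<open>derived_set\<close> consists of the products
    \<open>x y x^-1 y^-1\<close>, so the witnesses are the inverses.\<close>
  show "commutator G x y \<in> derived_set G (carrier G)"
    using assms by (intro UN_I[of "inv x"] UN_I[of "inv y"]) (simp_all add: commutator_def)
qed

end

text \<open>The relations alone suffice to express elements by basic commutators. That they define
  the group enters later, when homomorphisms out of it are constructed.\<close>

locale involution_system = group G for G (structure) +
  fixes g :: "'i::linorder \<Rightarrow> 'a" and V :: "'i set" and K :: "'i set set"
  assumes complex: "simplicial_complex_on V K"
    and finite_V: "finite V"
    and g_closed [simp]: "i \<in> V \<Longrightarrow> g i \<in> carrier G"
    and g_square [simp]: "i \<in> V \<Longrightarrow> g i \<otimes> g i = \<one>"
    and g_commute: "{i, j} \<in> K \<Longrightarrow> g i \<otimes> g j = g j \<otimes> g i"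
begin

lemma inv_g [simp]: "i \<in> V \<Longrightarrow> inv (g i) = g i"
  by (rule inv_equality) simp_all

lemma g_cancel [simp]: "i \<in> V \<Longrightarrow> x \<in> carrier G \<Longrightarrow> g i \<otimes> (g i \<otimes> x) = x"
  by (simp flip: m_assoc)

abbreviation commutators :: "'i list \<Rightarrow> 'a \<Rightarrow> 'a" where
  "commutators ks c \<equiv> foldr (\<lambda>k c. commutator G (g k) c) ks c"

lemma commutators_closed:
  "set ks \<subseteq> V \<Longrightarrow> c \<in> carrier G \<Longrightarrow> commutators ks c \<in> carrier G"
  by (induction ks) (auto simp: commutator_closed)

lemma iterated_commutator_in_derived:
  assumes "set ks \<subseteq> V" "j \<in> V" "i \<in> V"
  shows "iterated_commutator G g ks j i \<in> derived G (carrier G)"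
proof (cases ks)
  case (Cons k ls)
  then show ?thesis
    using assms commutators_closed[of ls] unfolding iterated_commutator_def
    by (auto intro!: commutator_in_derived simp: commutator_closed)
qed (use assms in \<open>auto simp: iterated_commutator_def intro: commutator_in_derived\<close>)

definition word_prod :: "'i list \<Rightarrow> 'a" where
  "word_prod ks = foldr (\<lambda>k x. g k \<otimes> x) ks \<one>"

lemma word_prod_Nil [simp]: "word_prod [] = \<one>"
  by (simp add: word_prod_def)

lemma word_prod_Cons [simp]: "word_prod (k # ks) = g k \<otimes> word_prod ks"
  by (simp add: word_prod_def)

lemma word_prod_closed: "set ks \<subseteq> V \<Longrightarrow> word_prod ks \<in> carrier G"
  by (induction ks) auto

lemma word_prod_snoc: "set ks \<subseteq> V \<Longrightarrow> j \<in> V \<Longrightarrow> word_prod (ks @ [j]) = word_prod ks \<otimes> g j"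
  by (induction ks) (auto simp: m_assoc word_prod_closed)

text \<open>
  Since \<open>(g\<^sub>k, x) = g\<^sub>k x\<^sup>-\<^sup>1 g\<^sub>k \<cdot> x\<close>, a subgroup containing \<open>x\<close> contains \<open>(g\<^sub>k, x)\<close> if and only if
  it contains the conjugate of \<open>x\<close> by \<open>g\<^sub>k\<close>.
\<close>

lemma conj_word_prod_in_subgroup:
  assumes "subgroup H G" "set ks \<subseteq> V" "c \<in> carrier G"
    and "\<And>ls. ls \<in> set (subseqs ks) \<Longrightarrow> commutators ls c \<in> H"
  shows "word_prod ks \<otimes> c \<otimes> inv (word_prod ks) \<in> H"
  using assms
proof (induction ks arbitrary: H)
  case Nil
  then show ?case by simp
next
  case (Cons k ks)
  interpret H: subgroup H G by fact
  have k: "k \<in> V" and ks: "set ks \<subseteq> V"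
    using Cons.prems by auto
  \<comment> \<open>The elements of \<open>H\<close> whose conjugate by \<open>g k\<close> remains
    in \<open>H\<close> form a subgroup, to which the induction hypothesis is applied. Its premise
    holds because \<open>ls\<close> and \<open>k # ls\<close> are both sublists of
    \<open>k # ks\<close>.\<close>
  define H' where "H' = {x \<in> H. g k \<otimes> x \<otimes> g k \<in> H}"
  have "subgroup H' G"
  proof
    fix x y assume xy: "x \<in> H'" "y \<in> H'"
    have "g k \<otimes> (x \<otimes> y) \<otimes> g k = (g k \<otimes> x \<otimes> g k) \<otimes> (g k \<otimes> y \<otimes> g k)"
      using xy k by (simp add: H'_def m_assoc)
    then show "x \<otimes> y \<in> H'"
      using xy by (auto simp: H'_def)
  next
    fix x assume x: "x \<in> H'"
    have "g k \<otimes> inv x \<otimes> g k = inv (g k \<otimes> x \<otimes> g k)"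
      using x k by (simp add: H'_def m_assoc inv_mult_group)
    then show "inv x \<in> H'"
      using x by (auto simp: H'_def)
  qed (use k in \<open>auto simp: H'_def\<close>)
  moreover have "commutators ls c \<in> H'" if "ls \<in> set (subseqs ks)" for ls
  proof -
    let ?x = "commutators ls c"
    have x: "?x \<in> H" "commutator G (g k) ?x \<in> H"
      using Cons.prems(4)[of ls] Cons.prems(4)[of "k # ls"] that by (auto simp: Let_def)
    have "g k \<otimes> ?x \<otimes> g k = ?x \<otimes> inv (commutator G (g k) ?x)"
      using x(1) k by (simp add: commutator_def inv_mult_group m_assoc inv_mult_cancel)
    then show ?thesis
      using x by (simp add: H'_def)
  qed
  ultimately have "word_prod ks \<otimes> c \<otimes> inv (word_prod ks) \<in> H'"
    using Cons.IH Cons.prems(3) ks by blast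
  then have "g k \<otimes> (word_prod ks \<otimes> c \<otimes> inv (word_prod ks)) \<otimes> g k \<in> H"
    by (simp add: H'_def)
  then show ?case
    using k Cons.prems(3) word_prod_closed[OF ks] by (simp add: inv_mult_group m_assoc)
qed

section \<open>Transversal and Schreier generators\<close>

definition transversal :: "'i set \<Rightarrow> 'a" where
  "transversal A = word_prod (sorted_list_of_set A)"

lemma transversal_empty [simp]: "transversal {} = \<one>"
  by (simp add: transversal_def)

lemma transversal_closed [simp]: "A \<subseteq> V \<Longrightarrow> transversal A \<in> carrier G"
  using finite_subset[OF _ finite_V, of A] by (simp add: transversal_def word_prod_closed)

lemma transversal_Max:
  assumes "J \<subseteq> V" "J \<noteq> {}"
  shows "transversal J = transversal (J - {Max J}) \<otimes> g (Max J)"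
proof -
  have fin: "finite J"
    using assms finite_V finite_subset by blast
  then have Max: "Max J \<in> J"
    using assms by simp
  have "a < Max J" if "a \<in> J - {Max J}" for a
    using that Max_ge[OF fin, of a] by auto
  then have "sorted_list_of_set (insert (Max J) (J - {Max J})) = sorted_list_of_set (J - {Max J}) @ [Max J]"
    using fin by (intro sorted_list_of_set_insert_greater) auto
  then have "sorted_list_of_set J = sorted_list_of_set (J - {Max J}) @ [Max J]"
    using Max by (simp add: insert_absorb)
  moreover have "Max J \<in> V"
    using Max assms(1) by blast
  ultimately show ?thesis
    using assms(1) fin by (simp only: transversal_def) (intro word_prod_snoc, auto)
qed

definition schreier_gen :: "'i set \<Rightarrow> 'i \<Rightarrow> 'a" where
  "schreier_gen J i = transversal (J - {i}) \<otimes> g i \<otimes> inv (transversal J)"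

lemma schreier_gen_closed [simp]: "J \<subseteq> V \<Longrightarrow> i \<in> J \<Longrightarrow> schreier_gen J i \<in> carrier G"
  unfolding schreier_gen_def by (intro m_closed inv_closed transversal_closed g_closed) auto

lemma schreier_gen_Max: "J \<subseteq> V \<Longrightarrow> J \<noteq> {} \<Longrightarrow> schreier_gen J (Max J) = \<one>"
  using transversal_Max[of J] finite_subset[OF _ finite_V, of J] transversal_closed[of J]
  by (simp add: schreier_gen_def)

text \<open>Removing \<open>i\<close> keeps the maximum \<open>j\<close>, so both representatives
  end in \<open>g j\<close>, and the middle of the product becomes
  \<open>g j g i g j = (g j, g i) g i\<close>.\<close>

lemma schreier_gen_step:
  assumes "J \<subseteq> V" "i \<in> J" "i \<noteq> Max J"
  shows "schreier_gen J i =
    transversal (J - {i, Max J}) \<otimes> commutator G (g (Max J)) (g i) \<otimes> inv (transversal (J - {i, Max J})) \<otimes>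
    schreier_gen (J - {Max J}) i"
proof -
  let ?j = "Max J" and ?B = "J - {i, Max J}"
  have fin: "finite J"
    using assms finite_V finite_subset by blast
  have j: "?j \<in> J"
    using assms(2) Max_in[OF fin] by blast
  have "Max (J - {i}) = ?j"
    using fin j assms by (intro Max_eqI) auto
  then have "transversal (J - {i}) = transversal (J - {i} - {?j}) \<otimes> g ?j"
    using transversal_Max[of "J - {i}"] assms j by auto
  moreover have "J - {i} - {?j} = ?B" "J - {?j} - {i} = ?B"
    by auto
  moreover have "transversal J = transversal (J - {?j}) \<otimes> g ?j"
    using assms by (intro transversal_Max) auto
  moreover have "transversal ?B \<in> carrier G" "transversal (J - {?j}) \<in> carrier G" "i \<in> V" "?j \<in> V"
    using assms j by (auto intro!: transversal_closed)
  ultimately show ?thesis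
    by (simp add: schreier_gen_def commutator_def inv_mult_group m_assoc inv_mult_cancel)
qed

text \<open>The relation of the square spanned by two commuting generators in the Cayley graph of
  the quotient by the commutator subgroup.\<close>

lemma schreier_gen_square:
  assumes "J \<subseteq> V" "i \<in> J" "i' \<in> J" "i \<noteq> i'" "{i, i'} \<in> K"
  shows "schreier_gen (J - {i'}) i \<otimes> schreier_gen J i' = schreier_gen (J - {i}) i' \<otimes> schreier_gen J i"
proof -
  let ?B = "J - {i, i'}"
  have B: "J - {i'} - {i} = ?B" "J - {i} - {i'} = ?B"
    by auto
  have cl: "transversal ?B \<in> carrier G" "transversal J \<in> carrier G" "transversal (J - {i}) \<in> carrier G"
    "transversal (J - {i'}) \<in> carrier G" "i \<in> V" "i' \<in> V"
    using assms by (auto intro!: transversal_closed)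
  have "g i \<otimes> (g i' \<otimes> x) = g i' \<otimes> (g i \<otimes> x)" if "x \<in> carrier G" for x
    using that cl g_commute[OF assms(5)] by (simp flip: m_assoc)
  then show ?thesis
    using cl by (simp add: schreier_gen_def B m_assoc inv_mult_cancel)
qed

text \<open>Indexing by the vertex set \<open>J\<close> loses nothing: in an admissible commutator
  \<open>j\<close> exceeds all other vertices and the list \<open>ks\<close> is increasing.\<close>

definition basic_commutator :: "'i set \<Rightarrow> 'i \<Rightarrow> 'a" where
  "basic_commutator J i = iterated_commutator G g (sorted_list_of_set (J - {i, Max J})) (Max J) i"

definition basic_commutators :: "'a set" where
  "basic_commutators = {basic_commutator J i | J i. J \<subseteq> V \<and> i \<in> component_minima K J}"

lemma basic_commutator_in_derived:
  assumes "J \<subseteq> V" "i \<in> J"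
  shows "basic_commutator J i \<in> derived G (carrier G)"
proof -
  have "finite J"
    using assms finite_V finite_subset by blast
  then have "Max J \<in> J"
    using assms(2) Max_in by blast
  then show ?thesis
    unfolding basic_commutator_def using assms \<open>finite J\<close>
    by (intro iterated_commutator_in_derived) auto
qed

text \<open>Each sublist of the conjugating word, together with \<open>i\<close> and
  \<open>Max J\<close>, spans a smaller vertex set with the same maximum, on which \<open>i\<close>
  is again a component minimum. All commutators required by
  \<open>conj_word_prod_in_subgroup\<close> are thus basic.\<close>

lemma conj_commutator_in_subgroup:
  assumes H: "subgroup H G" "basic_commutators \<subseteq> H"
    and J: "J \<subseteq> V" and i: "i \<in> component_minima K J"
  shows "transversal (J - {i, Max J}) \<otimes> commutator G (g (Max J)) (g i) \<otimes>
    inv (transversal (J - {i, Max J})) \<in> H"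
  unfolding transversal_def
proof (rule conj_word_prod_in_subgroup[OF H(1)])
  have fin: "finite J"
    using J finite_V finite_subset by blast
  have iJ: "i \<in> J" and less: "i < Max J"
    using i component_minima_less_Max[OF fin] by (auto simp: component_minima_def)
  then have j: "Max J \<in> J"
    using Max_in[OF fin] by blast
  show "commutator G (g (Max J)) (g i) \<in> carrier G"
    using iJ j J by (auto intro!: commutator_closed)
  show "set (sorted_list_of_set (J - {i, Max J})) \<subseteq> V"
    using fin J by auto
  fix ls assume ls: "ls \<in> set (subseqs (sorted_list_of_set (J - {i, Max J})))"
  define J' where "J' = insert i (insert (Max J) (set ls))"
  have "set ls \<subseteq> J - {i, Max J}"
    using ls fin subseqs_powset[of "sorted_list_of_set (J - {i, Max J})"] by auto
  then have J': "J' \<subseteq> J" "J' - {i, Max J} = set ls"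
    using iJ j by (auto simp: J'_def)
  have Max: "Max J' = Max J"
    using fin J' less by (intro Max_eqI) (auto simp: J'_def finite_subset)
  have "sorted_wrt (<) ls"
    using sorted_wrt_subseqs[OF _ ls] strict_sorted_list_of_set by blast
  then have "commutators ls (commutator G (g (Max J)) (g i)) = basic_commutator J' i"
    by (simp add: basic_commutator_def iterated_commutator_def Max J' sorted_list_of_set_set)
  moreover have "i \<in> component_minima K J'"
    using component_minima_subset[OF i J'(1) _ Max] by (simp add: J'_def)
  ultimately show "commutators ls (commutator G (g (Max J)) (g i)) \<in> H"
    using H(2) J J'(1) unfolding basic_commutators_def by blast
qed

text \<open>Induction over proper subsets of \<open>J\<close>. Moving along edges, it is enough to
  treat one vertex in each component: \<open>Max J\<close>, whose generator is trivial, or the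
  component minimum, for which \<open>schreier_gen_step\<close> applies.\<close>

lemma schreier_gen_in_subgroup:
  assumes H: "subgroup H G" "basic_commutators \<subseteq> H"
    and "J \<subseteq> V" "i \<in> J"
  shows "schreier_gen J i \<in> H"
proof -
  have "finite J"
    using assms finite_V finite_subset by blast
  then show ?thesis
    using assms(3,4)
  proof (induction J arbitrary: i rule: finite_psubset_induct)
    case (psubset J)
    interpret H: subgroup H G by fact
    \<comment> \<open>Solve the square relation for \<open>schreier_gen J v\<close>: the other two
      factors besides \<open>schreier_gen J u\<close> live on proper subsets of
      \<open>J\<close>.\<close>
    have edge: "schreier_gen J v \<in> H"
      if uv: "{u, v} \<in> full_subcomplex K J" "schreier_gen J u \<in> H" for u v
    proof (cases "u = v")
      case False
      have uv': "u \<in> J" "v \<in> J" "{u, v} \<in> K"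
        using uv(1) by (auto simp: full_subcomplex_def)
      have lower: "schreier_gen (J - {v}) u \<in> H" "schreier_gen (J - {u}) v \<in> H"
        using psubset.prems uv' False by (auto intro!: psubset.IH)
      have "schreier_gen J v = inv (schreier_gen (J - {v}) u) \<otimes>
          (schreier_gen (J - {v}) u \<otimes> schreier_gen J v)"
        using psubset.prems(1) uv'(2) lower by (simp add: inv_mult_cancel)
      also have "\<dots> = inv (schreier_gen (J - {v}) u) \<otimes>
          (schreier_gen (J - {u}) v \<otimes> schreier_gen J u)"
        using schreier_gen_square[OF psubset.prems(1) uv'(1,2) False uv'(3)] by simp
      also have "\<dots> \<in> H"
        using lower uv(2) by simp
      finally show ?thesis .
    qed (use uv in simp)
    have component: "schreier_gen J v \<in> H"
      if "(u, v) \<in> same_component K J" "schreier_gen J u \<in> H" for u v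
      using that(1) unfolding same_component_def
    proof (induction rule: rtrancl_induct)
      case (step v w)
      then show ?case
        using edge[of v w] by simp
    qed (use that(2) in simp)
    show ?case
    proof (cases "(i, Max J) \<in> same_component K J")
      case True
      have "J \<noteq> {}"
        using psubset.prems by auto
      then show ?thesis
        using component[OF same_component_sym[OF True]] schreier_gen_Max[OF psubset.prems(1)] by simp
    next
      case False
      then obtain i0 where i0: "i0 \<in> component_minima K J" "(i0, i) \<in> same_component K J"
        by (rule component_minimum_exists[OF psubset.hyps(1) psubset.prems(2)])
      have "i0 \<in> J" "i0 \<noteq> Max J"
        using i0(1) by (auto simp: component_minima_def)
      have "Max J \<in> J"
        using Max_in[OF psubset.hyps(1)] psubset.prems(2) by blast
      then have "schreier_gen (J - {Max J}) i0 \<in> H"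
        using psubset.prems(1) \<open>i0 \<in> J\<close> \<open>i0 \<noteq> Max J\<close>
        by (intro psubset.IH) (blast, blast, simp)
      with \<open>i0 \<in> J\<close> \<open>i0 \<noteq> Max J\<close> have "schreier_gen J i0 \<in> H"
        using H.m_closed[OF conj_commutator_in_subgroup[OF H psubset.prems(1) i0(1)]]
          schreier_gen_step[OF psubset.prems(1)] by simp
      then show ?thesis
        by (rule component[OF i0(2)])
    qed
  qed
qed

text \<open>The products \<open>h \<otimes> transversal A\<close> are closed under right
  multiplication by each \<open>g i\<close>, which inserts \<open>i\<close> into \<open>A\<close> or
  deletes it at the cost of a Schreier generator in \<open>H\<close>. Starting from
  \<open>\<one>\<close>, they exhaust the generated subgroup.\<close>

lemma coset_transversal:
  assumes H: "subgroup H G" "basic_commutators \<subseteq> H"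
    and x: "x \<in> generate G (g ` V)"
  obtains h A where "h \<in> H" "A \<subseteq> V" "x = h \<otimes> transversal A"
proof -
  interpret H: subgroup H G by fact
  define Y where "Y = {h \<otimes> transversal A | h A. h \<in> H \<and> A \<subseteq> V}"
  have step: "y \<otimes> g i \<in> Y" if y: "y \<in> Y" and i: "i \<in> V" for y i
  proof -
    obtain h A where hA: "h \<in> H" "A \<subseteq> V" "y = h \<otimes> transversal A"
      using y by (auto simp: Y_def)
    show ?thesis
    proof (cases "i \<in> A")
      case True
      have "transversal (A - {i}) \<in> carrier G"
        by (rule transversal_closed) (use hA(2) in blast)
      then have "y \<otimes> g i = h \<otimes> inv (schreier_gen A i) \<otimes> transversal (A - {i})"
        using hA i by (simp add: schreier_gen_def inv_mult_group m_assoc inv_mult_cancel)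
      moreover have "schreier_gen A i \<in> H"
        using schreier_gen_in_subgroup[OF H hA(2) True] .
      ultimately show ?thesis
        using hA unfolding Y_def by blast
    next
      case False
      moreover have "transversal (insert i A) \<in> carrier G"
        by (rule transversal_closed) (use hA(2) i in blast)
      ultimately have "y \<otimes> g i = h \<otimes> schreier_gen (insert i A) i \<otimes> transversal (insert i A)"
        using hA i by (simp add: schreier_gen_def m_assoc)
      moreover have "schreier_gen (insert i A) i \<in> H"
        using schreier_gen_in_subgroup[OF H, of "insert i A" i] hA i by auto
      ultimately show ?thesis
        using hA i unfolding Y_def by blast
    qed
  qed
  have Y: "Y \<subseteq> carrier G"
    using transversal_closed by (fastforce simp: Y_def)
  have gen: "generate G (g ` V) \<subseteq> carrier G"
    by (rule generate_incl) auto
  have "\<forall>y\<in>Y. y \<otimes> x \<in> Y"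
    using x
  proof (induction rule: generate.induct)
    case (eng a b)
    have "a \<in> carrier G" "b \<in> carrier G"
      using eng(1,2) gen by auto
    then show ?case
      using eng(3,4) Y by (metis m_assoc subsetD)
  next
    case (inv h)
    then show ?case
      using step by force
  qed (use Y step in auto)
  moreover have "\<one> \<otimes> transversal {} \<in> Y"
    unfolding Y_def by (intro CollectI exI conjI) (rule refl, auto)
  ultimately have "\<one> \<otimes> transversal {} \<otimes> x \<in> Y"
    by blast
  then have "x \<in> Y"
    using x gen by auto
  then show thesis
    using that by (auto simp: Y_def)
qed

end

section \<open>A lower bound for the number of generators\<close>

text \<open>Gaussian elimination without division.\<close>

lemma homogeneous_system_nontrivial_solution:
  fixes a :: "'p \<Rightarrow> 't \<Rightarrow> int"
  assumes "finite T" "finite P" "card T < card P"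
  obtains c where "\<exists>p\<in>P. c p \<noteq> 0" "\<And>t. t \<in> T \<Longrightarrow> (\<Sum>p\<in>P. c p * a p t) = 0"
proof -
  have "\<exists>c. (\<exists>p\<in>P. c p \<noteq> 0) \<and> (\<forall>t\<in>T. (\<Sum>p\<in>P. c p * a p t) = 0)"
    using assms
  proof (induction T arbitrary: P a rule: finite_induct)
    case empty
    then show ?case
      by (intro exI[of _ "\<lambda>_. 1"]) (auto simp: card_gt_0_iff)
  next
    case (insert t T)
    show ?case
    proof (cases "\<exists>p\<in>P. a p t \<noteq> 0")
      case True
      then obtain q where q: "q \<in> P" "a q t \<noteq> 0"
        by blast
      let ?P = "P - {q}"
      have "card T < card ?P"
        using insert.hyps insert.prems q by simp
      then obtain c where c: "\<exists>p\<in>?P. c p \<noteq> 0"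
        "\<And>s. s \<in> T \<Longrightarrow> (\<Sum>p\<in>?P. c p * (a q t * a p s - a p t * a q s)) = 0"
        using insert.IH[of ?P "\<lambda>p s. a q t * a p s - a p t * a q s"] insert.prems(1) by auto
      \<comment> \<open>All other coefficients are scaled by the pivot \<open>a q t\<close>, and
        \<open>d q\<close> is chosen so that equation \<open>t\<close> cancels.\<close>
      define d where "d p = (if p = q then - (\<Sum>p\<in>?P. c p * a p t) else a q t * c p)" for p
      have sum: "(\<Sum>p\<in>P. d p * a p s) = (\<Sum>p\<in>?P. c p * (a q t * a p s - a p t * a q s))" for s
      proof -
        have "(\<Sum>p\<in>P. d p * a p s) = d q * a q s + (\<Sum>p\<in>?P. d p * a p s)"
          using insert.prems(1) q(1) by (simp add: sum.remove)
        also have "(\<Sum>p\<in>?P. d p * a p s) = (\<Sum>p\<in>?P. a q t * c p * a p s)"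
          by (rule sum.cong) (auto simp: d_def)
        also have "d q * a q s + (\<Sum>p\<in>?P. a q t * c p * a p s) =
            (\<Sum>p\<in>?P. c p * (a q t * a p s - a p t * a q s))"
          by (simp add: d_def sum_distrib_left sum_distrib_right sum_subtractf algebra_simps)
        finally show ?thesis .
      qed
      have "\<exists>p\<in>P. d p \<noteq> 0"
        using c(1) q by (auto simp: d_def)
      moreover have "(\<Sum>p\<in>P. d p * a p s) = 0" if "s \<in> insert t T" for s
        using that c(2)[of s] unfolding sum by (auto simp: mult.commute)
      ultimately show ?thesis
        by blast
    next
      case False
      obtain c where "\<exists>p\<in>P. c p \<noteq> 0" "\<forall>s\<in>T. (\<Sum>p\<in>P. c p * a p s) = 0"
        using insert.IH[of P a] insert.prems insert.hyps by auto
      moreover have "(\<Sum>p\<in>P. c p * a p t) = 0"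
        using False by (intro sum.neutral) auto
      ultimately show ?thesis
        by auto
    qed
  qed
  then show thesis
    using that by blast
qed

text \<open>Forward substitution along \<open>r\<close>: off the diagonal, row \<open>q\<close>
  involves only unknowns of smaller rank, which already vanish.\<close>

lemma triangular_system_trivial_solution:
  fixes M :: "'p \<Rightarrow> 'p \<Rightarrow> int" and r :: "'p \<Rightarrow> nat"
  assumes fin: "finite P"
    and diag: "\<And>p. p \<in> P \<Longrightarrow> M p p \<noteq> 0"
    and tri: "\<And>p q. p \<in> P \<Longrightarrow> q \<in> P \<Longrightarrow> M p q \<noteq> 0 \<Longrightarrow> q = p \<or> r q < r p"
    and sol: "\<And>p. p \<in> P \<Longrightarrow> (\<Sum>q\<in>P. c q * M p q) = 0"
    and q: "q \<in> P"
  shows "c q = 0"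
  using q
proof (induction "r q" arbitrary: q rule: less_induct)
  case less
  have "(\<Sum>p\<in>P. c p * M q p) = c q * M q q"
  proof -
    have "c p * M q p = 0" if "p \<in> P - {q}" for p
      using tri[of q p] less that by (cases "M q p = 0") auto
    then have "(\<Sum>p\<in>P - {q}. c p * M q p) = 0"
      by (intro sum.neutral) blast
    then show ?thesis
      using sum.remove[OF fin less.prems, of "\<lambda>p. c p * M q p"] by simp
  qed
  then show ?case
    using sol[OF less.prems] diag[OF less.prems] by simp
qed

text \<open>The coefficients are the exponent sums of a word for \<open>x\<close> in
  \<open>T\<close>. The point is that one choice of \<open>a\<close> works for all \<open>p\<close>
  simultaneously.\<close>

lemma (in group) hom_int_generate_combination:
  fixes \<phi> :: "'p \<Rightarrow> 'a \<Rightarrow> int"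
  assumes H: "subgroup H G" "T \<subseteq> H" "finite T"
    and add: "\<And>p x y. p \<in> P \<Longrightarrow> x \<in> H \<Longrightarrow> y \<in> H \<Longrightarrow> \<phi> p (x \<otimes> y) = \<phi> p x + \<phi> p y"
    and x: "x \<in> generate G T"
  shows "\<exists>a. \<forall>p\<in>P. \<phi> p x = (\<Sum>t\<in>T. a t * \<phi> p t)"
proof -
  interpret H: subgroup H G by fact
  have one: "\<phi> p \<one> = 0" if "p \<in> P" for p
    using add[OF that H.one_closed H.one_closed] by simp
  have inv: "\<phi> p (inv y) = - \<phi> p y" if "p \<in> P" "y \<in> H" for p y
    using add[OF that(1) that(2) H.m_inv_closed[OF that(2)]] one[OF that(1)] H.mem_carrier[OF that(2)] by simp
  have mem: "\<phi> p t = (\<Sum>s\<in>T. (if s = t then 1 else 0) * \<phi> p s)" if "t \<in> T" for p t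
    using that H(3) by (simp add: if_distrib[of "\<lambda>z. z * _"] sum.delta cong: if_cong)
  show ?thesis
    using x
  proof (induction rule: generate.induct)
    case one
    then show ?case
      using \<open>\<And>p. p \<in> P \<Longrightarrow> \<phi> p \<one> = 0\<close> by (intro exI[of _ "\<lambda>_. 0"]) simp
  next
    case (incl h)
    then show ?case
      using mem by (intro exI[of _ "\<lambda>s. if s = h then 1 else 0"]) blast
  next
    case (inv h)
    have "\<phi> p (inv h) = (\<Sum>s\<in>T. - (if s = h then 1 else 0) * \<phi> p s)" if "p \<in> P" for p
      using mem[OF inv] \<open>\<And>p y. p \<in> P \<Longrightarrow> y \<in> H \<Longrightarrow> \<phi> p (inv y) = - \<phi> p y\<close>[OF that, of h] inv H(2)
      by (auto simp: sum_negf)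
    then show ?case
      by (intro exI[of _ "\<lambda>s. - (if s = h then 1 else 0)"]) blast
  next
    case (eng y z)
    then obtain a b where "\<forall>p\<in>P. \<phi> p y = (\<Sum>t\<in>T. a t * \<phi> p t)" "\<forall>p\<in>P. \<phi> p z = (\<Sum>t\<in>T. b t * \<phi> p t)"
      by blast
    moreover have "y \<in> H" "z \<in> H"
      using eng(1,2) generate_subgroup_incl[OF H(2,1)] by auto
    ultimately show ?case
      by (intro exI[of _ "\<lambda>t. a t + b t"]) (simp add: add distrib_right sum.distrib)
  qed
qed

text \<open>If \<open>T\<close> had fewer elements than \<open>P\<close>, the exponent vectors of
  the \<open>s q\<close> would satisfy a nontrivial linear relation. The same relation would hold
  among the columns of the matrix \<open>\<phi> p (s q)\<close>, which is triangular with nonzero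
  diagonal.\<close>

lemma (in group) card_generating_set_ge:
  fixes \<phi> :: "'p \<Rightarrow> 'a \<Rightarrow> int" and r :: "'p \<Rightarrow> nat"
  assumes H: "subgroup H G" "generates G H T" "finite T"
    and add: "\<And>p x y. p \<in> P \<Longrightarrow> x \<in> H \<Longrightarrow> y \<in> H \<Longrightarrow> \<phi> p (x \<otimes> y) = \<phi> p x + \<phi> p y"
    and P: "finite P" "\<And>p. p \<in> P \<Longrightarrow> s p \<in> H"
    and diag: "\<And>p. p \<in> P \<Longrightarrow> \<phi> p (s p) \<noteq> 0"
    and tri: "\<And>p q. p \<in> P \<Longrightarrow> q \<in> P \<Longrightarrow> \<phi> p (s q) \<noteq> 0 \<Longrightarrow> q = p \<or> r q < r p"
  shows "card P \<le> card T"
proof (rule ccontr)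
  assume "\<not> card P \<le> card T"
  have "\<exists>a. \<forall>p\<in>P. \<phi> p (s q) = (\<Sum>t\<in>T. a t * \<phi> p t)" if "q \<in> P" for q
    by (rule hom_int_generate_combination[OF H(1) _ H(3) add])
      (use H(2) P(2)[OF that] in \<open>auto simp: generates_def\<close>)
  then obtain a where a: "\<And>p q. p \<in> P \<Longrightarrow> q \<in> P \<Longrightarrow> \<phi> p (s q) = (\<Sum>t\<in>T. a q t * \<phi> p t)"
    by metis
  obtain c where c: "\<exists>p\<in>P. c p \<noteq> 0" "\<And>t. t \<in> T \<Longrightarrow> (\<Sum>q\<in>P. c q * a q t) = 0"
    using homogeneous_system_nontrivial_solution[OF H(3) P(1), of a] \<open>\<not> card P \<le> card T\<close> by auto
  have "(\<Sum>q\<in>P. c q * \<phi> p (s q)) = 0" if "p \<in> P" for p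
  proof -
    have "(\<Sum>q\<in>P. c q * \<phi> p (s q)) = (\<Sum>q\<in>P. \<Sum>t\<in>T. c q * a q t * \<phi> p t)"
      by (intro sum.cong refl) (simp add: a[OF that] sum_distrib_left mult.assoc)
    also have "\<dots> = (\<Sum>t\<in>T. (\<Sum>q\<in>P. c q * a q t) * \<phi> p t)"
      by (subst sum.swap) (simp add: sum_distrib_right)
    also have "\<dots> = 0"
      using c(2) by simp
    finally show ?thesis .
  qed
  then have "c p = 0" if "p \<in> P" for p
    using triangular_system_trivial_solution[OF P(1), of "\<lambda>p q. \<phi> p (s q)" r c p] diag tri that by blast
  then show False
    using c(1) by blast
qed

section \<open>Dihedral quotients\<close>

text \<open>The pair \<open>(a, s)\<close> stands for the isometry \<open>x \<mapsto> a + s x\<close> of the integers.\<close>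

definition infinite_dihedral :: "(int \<times> int) monoid" where
  "infinite_dihedral =
     \<lparr>carrier = UNIV \<times> {1, -1},
      monoid.mult = (\<lambda>(a, s) (b, t). (a + s * b, s * t)),
      one = (0, 1)\<rparr>"

lemma group_infinite_dihedral: "group infinite_dihedral"
proof (rule groupI)
  fix x assume "x \<in> carrier infinite_dihedral"
  then show "\<exists>y\<in>carrier infinite_dihedral. y \<otimes>\<^bsub>infinite_dihedral\<^esub> x = \<one>\<^bsub>infinite_dihedral\<^esub>"
    by (intro bexI[of _ "(- snd x * fst x, snd x)"]) (auto simp: infinite_dihedral_def)
qed (auto simp: infinite_dihedral_def algebra_simps)

lemma inv_infinite_dihedral:
  "s \<in> {1, -1} \<Longrightarrow> inv\<^bsub>infinite_dihedral\<^esub> (a, s) = (- s * a, s)"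
  by (rule group.inv_equality[OF group_infinite_dihedral]) (auto simp: infinite_dihedral_def)

lemma mult_infinite_dihedral [simp]:
  "(a, s) \<otimes>\<^bsub>infinite_dihedral\<^esub> (b, t) = (a + s * b, s * t)"
  by (simp add: infinite_dihedral_def)

lemma one_infinite_dihedral: "\<one>\<^bsub>infinite_dihedral\<^esub> = (0, 1)"
  by (simp add: infinite_dihedral_def)

lemma carrier_infinite_dihedral [simp]: "(a, s) \<in> carrier infinite_dihedral \<longleftrightarrow> s = 1 \<or> s = -1"
  by (simp add: infinite_dihedral_def)

text \<open>Conjugation by a reflection inverts translations, so each further commutator with a
  reflection doubles the translation.\<close>

lemma commutator_infinite_dihedral:
  "commutator infinite_dihedral (a, -1) (b, -1) = (2 * (a - b), 1)"
  "commutator infinite_dihedral (a, -1) (t, 1) = (2 * t, 1)"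
  "s \<in> {1, -1} \<Longrightarrow> commutator infinite_dihedral (0, 1) (b, s) = (0, 1)"
  "s \<in> {1, -1} \<Longrightarrow> commutator infinite_dihedral (b, s) (0, 1) = (0, 1)"
  by (auto simp: commutator_def inv_infinite_dihedral)

lemma (in group_hom) commutator_hom:
  "x \<in> carrier G \<Longrightarrow> y \<in> carrier G \<Longrightarrow> h (commutator G x y) = commutator H (h x) (h y)"
  by (simp add: commutator_def)

text \<open>The sign is a homomorphism to the commutative group of signs, hence trivial on
  commutators. Consequently the derived subgroup acts by translations, on which \<open>fst\<close>
  is additive.\<close>

lemma derived_infinite_dihedral:
  assumes "h \<in> hom G infinite_dihedral" "group G" "x \<in> derived G (carrier G)"
  shows "snd (h x) = 1"
proof -
  interpret h: group_hom G infinite_dihedral h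
    using assms group_infinite_dihedral by (simp add: group_hom_def group_hom_axioms_def)
  have sign: "snd (h y) = 1 \<or> snd (h y) = -1" if "y \<in> carrier G" for y
    using h.hom_closed[OF that] by (auto simp: infinite_dihedral_def)
  have mult: "snd (h (y \<otimes>\<^bsub>G\<^esub> z)) = snd (h y) * snd (h z)" if "y \<in> carrier G" "z \<in> carrier G" for y z
    using that by (cases "h y"; cases "h z") simp
  have inv: "snd (h (inv\<^bsub>G\<^esub> y)) = snd (h y)" if "y \<in> carrier G" for y
  proof -
    have "snd (h (inv\<^bsub>G\<^esub> y)) * snd (h y) = 1"
      using mult[of "inv\<^bsub>G\<^esub> y" y] that by (simp add: one_infinite_dihedral)
    then show ?thesis
      using sign[OF that] by auto
  qed
  have "derived G (carrier G) \<subseteq> {y \<in> carrier G. snd (h y) = 1}"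
  proof -
    have "subgroup {y \<in> carrier G. snd (h y) = 1} G"
      by (rule h.G.subgroupI)
        (auto simp: mult inv one_infinite_dihedral intro!: exI[of _ "\<one>\<^bsub>G\<^esub>"]
          simp del: h.hom_mult h.hom_inv)
    moreover have "derived_set G (carrier G) \<subseteq> {y \<in> carrier G. snd (h y) = 1}"
    proof -
      have "snd (h (y \<otimes>\<^bsub>G\<^esub> z \<otimes>\<^bsub>G\<^esub> inv\<^bsub>G\<^esub> y \<otimes>\<^bsub>G\<^esub> inv\<^bsub>G\<^esub> z)) = 1"
        if "y \<in> carrier G" "z \<in> carrier G" for y z
        using sign[OF that(1)] sign[OF that(2)] that
        by (auto simp: mult inv simp del: h.hom_mult h.hom_inv)
      then show ?thesis
        by (auto simp del: h.hom_mult h.hom_inv)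
    qed
    ultimately show ?thesis
      unfolding derived_def by (rule h.G.generate_subgroup_incl[rotated])
  qed
  then show ?thesis
    using assms(3) by blast
qed

text \<open>A vertex outside \<open>J\<close> acts as the identity and makes the commutator at its
  place trivial, and all outer commutators with it; vertices of \<open>J\<close> contribute a factor
  2 each.\<close>

lemma iterated_commutator_infinite_dihedral:
  fixes \<rho> :: "'i \<Rightarrow> int \<times> int"
  assumes "\<And>i. i \<in> J \<Longrightarrow> \<rho> i = (f i, -1)" "\<And>i. i \<notin> J \<Longrightarrow> \<rho> i = (0, 1)"
  shows "iterated_commutator infinite_dihedral \<rho> ks j i =
    (if set ks \<union> {j, i} \<subseteq> J then 2 ^ Suc (length ks) * (f j - f i) else 0, 1)"
proof (induction ks)
  case Nil
  then show ?case
    using assms(1)[of i] assms(2)[of i] assms(1)[of j] assms(2)[of j]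
    by (cases "i \<in> J"; cases "j \<in> J") (simp_all add: iterated_commutator_def commutator_infinite_dihedral)
next
  case (Cons k ks)
  have "iterated_commutator infinite_dihedral \<rho> (k # ks) j i =
      commutator infinite_dihedral (\<rho> k) (iterated_commutator infinite_dihedral \<rho> ks j i)"
    by (simp add: iterated_commutator_def)
  then show ?case
    using assms(1)[of k] assms(2)[of k] unfolding Cons
    by (cases "k \<in> J") (simp_all add: commutator_infinite_dihedral)
qed

lemma (in group_hom) iterated_commutator_hom:
  assumes "g ` (set ks \<union> {j, i}) \<subseteq> carrier G"
  shows "h (iterated_commutator G g ks j i) = iterated_commutator H (h \<circ> g) ks j i"
proof -
  have "h (iterated_commutator G g ks j i) = iterated_commutator H (h \<circ> g) ks j i \<and>
      iterated_commutator G g ks j i \<in> carrier G"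
    using assms by (induction ks)
      (auto simp: iterated_commutator_def commutator_hom G.commutator_closed)
  then show ?thesis ..
qed

lemma iterated_commutator_cong:
  assumes "\<And>k. k \<in> set ks \<union> {j, i} \<Longrightarrow> \<rho> k = \<rho>' k"
  shows "iterated_commutator G \<rho> ks j i = iterated_commutator G \<rho>' ks j i"
  unfolding iterated_commutator_def by (rule foldr_cong) (use assms in auto)

section \<open>Generation and minimality in the right-angled Coxeter group\<close>

definition minima_pairs :: "'i::linorder set \<Rightarrow> 'i set set \<Rightarrow> ('i set \<times> 'i) set" where
  "minima_pairs V K = Sigma (Pow V) (component_minima K)"

lemma finite_minima_pairs: "finite V \<Longrightarrow> finite (minima_pairs V K)"
  unfolding minima_pairs_def
  by (intro finite_SigmaI) (auto simp: component_minima_def intro: finite_subset)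

context
  fixes V :: "'i::linorder set" and K :: "'i set set"
  assumes K: "simplicial_complex_on V K" and fin: "finite V"
begin

lemma involution_system_RC: "involution_system (RC V K) (RC_gen V K) V K"
  unfolding involution_system_def involution_system_axioms_def
  by (intro conjI allI impI group_RC RC_gen_closed RC_gen_square RC_gen_commute K fin)

interpretation involution_system "RC V K" "RC_gen V K" V K
  by (rule involution_system_RC)

text \<open>Vertices of \<open>J\<close> act as reflections of the integers; adjacent vertices of \<open>J\<close> must have the
  same centre.\<close>

lemma RC_dihedral_hom:
  fixes f :: "'i \<Rightarrow> int"
  assumes "\<And>u v. {u, v} \<in> full_subcomplex K J \<Longrightarrow> f u = f v"
  obtains \<theta> where "\<theta> \<in> hom (RC V K) infinite_dihedral"
    "\<And>i. i \<in> V \<Longrightarrow> \<theta> (RC_gen V K i) = (if i \<in> J then (f i, -1) else (0, 1))"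
proof (rule RC_universal[OF K group_infinite_dihedral, of "\<lambda>i. if i \<in> J then (f i, -1) else (0, 1)"])
  fix i j assume "{i, j} \<in> K"
  then show "(if i \<in> J then (f i, -1) else (0, 1)) \<otimes>\<^bsub>infinite_dihedral\<^esub> (if j \<in> J then (f j, -1) else (0, 1)) =
      (if j \<in> J then (f j, -1) else (0, 1)) \<otimes>\<^bsub>infinite_dihedral\<^esub> (if i \<in> J then (f i, -1) else (0, 1))"
    using assms[of i j] by (auto simp: full_subcomplex_def)
qed (auto simp: one_infinite_dihedral intro: that)

lemma basic_commutator_dihedral:
  assumes \<theta>: "\<theta> \<in> hom (RC V K) infinite_dihedral"
    "\<And>i. i \<in> V \<Longrightarrow> \<theta> (RC_gen V K i) = (if i \<in> J then (f i, -1) else (0, 1))"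
    and J': "J' \<subseteq> V" "i \<in> J'"
  shows "fst (\<theta> (basic_commutator J' i)) =
    (if J' \<subseteq> J then 2 ^ Suc (card (J' - {i, Max J'})) * (f (Max J') - f i) else 0)"
proof -
  have finJ': "finite J'"
    using J' fin finite_subset by blast
  have Max: "Max J' \<in> J'"
    using Max_in[OF finJ'] J'(2) by blast
  let ?ks = "sorted_list_of_set (J' - {i, Max J'})"
  have ks: "set ?ks \<union> {Max J', i} = J'"
    using finJ' Max J'(2) by auto
  interpret \<theta>: group_hom "RC V K" infinite_dihedral \<theta>
    using \<theta>(1) group_infinite_dihedral group_RC[OF K] by (simp add: group_hom_def group_hom_axioms_def)
  let ?\<rho> = "\<lambda>i. if i \<in> J then (f i, -1) else (0, 1)"
  have "\<theta> (basic_commutator J' i) = iterated_commutator infinite_dihedral (\<theta> \<circ> RC_gen V K) ?ks (Max J') i"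
    unfolding basic_commutator_def
    by (rule \<theta>.iterated_commutator_hom) (use ks J'(1) in auto)
  also have "\<dots> = iterated_commutator infinite_dihedral ?\<rho> ?ks (Max J') i"
    by (rule iterated_commutator_cong) (use ks J'(1) \<theta>(2) in auto)
  also have "\<dots> = (if set ?ks \<union> {Max J', i} \<subseteq> J then 2 ^ Suc (length ?ks) * (f (Max J') - f i) else 0, 1)"
    by (rule iterated_commutator_infinite_dihedral) auto
  finally show ?thesis
    unfolding ks by simp
qed

text \<open>Take for \<open>f\<close> the indicator function of the component of \<open>i\<close>,
  which misses \<open>Max J\<close>. On the same vertex set a nonzero value forces \<open>i'\<close>
  into that component, and two minima of one component coincide; any other contributing vertex set
  is a proper subset of \<open>J\<close>.\<close>

lemma triangular_dihedral_hom:
  assumes p: "(J, i) \<in> minima_pairs V K"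
  obtains \<theta> where "\<theta> \<in> hom (RC V K) infinite_dihedral" "fst (\<theta> (basic_commutator J i)) \<noteq> 0"
    "\<And>J' i'. (J', i') \<in> minima_pairs V K \<Longrightarrow> fst (\<theta> (basic_commutator J' i')) \<noteq> 0 \<Longrightarrow>
       (J', i') = (J, i) \<or> card J' < card J"
proof -
  have J: "J \<subseteq> V" and i: "i \<in> component_minima K J"
    using p by (auto simp: minima_pairs_def)
  define f :: "'i \<Rightarrow> int" where "f v = (if (i, v) \<in> same_component K J then 1 else 0)" for v
  have "f u = f v" if "{u, v} \<in> full_subcomplex K J" for u v
  proof -
    have "(u, v) \<in> same_component K J"
      using that unfolding same_component_def by blast
    then show ?thesis
      unfolding f_def using same_component_trans same_component_sym by metis
  qed
  then obtain \<theta> where \<theta>: "\<theta> \<in> hom (RC V K) infinite_dihedral"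
    "\<And>i. i \<in> V \<Longrightarrow> \<theta> (RC_gen V K i) = (if i \<in> J then (f i, -1) else (0, 1))"
    using RC_dihedral_hom by metis
  have Max: "f (Max J) = 0"
    using i by (simp add: component_minima_def f_def)
  show thesis
  proof (rule that[OF \<theta>(1)])
    have "i \<in> J"
      using i by (simp add: component_minima_def)
    then show "fst (\<theta> (basic_commutator J i)) \<noteq> 0"
      using basic_commutator_dihedral[OF \<theta> J] Max by (simp add: f_def)
  next
    fix J' i' assume p': "(J', i') \<in> minima_pairs V K" and nz: "fst (\<theta> (basic_commutator J' i')) \<noteq> 0"
    have J': "J' \<subseteq> V" and i': "i' \<in> component_minima K J'" "i' \<in> J'"
      using p' by (auto simp: minima_pairs_def component_minima_def)
    have sub: "J' \<subseteq> J" and neq: "f (Max J') \<noteq> f i'"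
      using nz basic_commutator_dihedral[OF \<theta> J' i'(2)] by (auto split: if_splits)
    show "(J', i') = (J, i) \<or> card J' < card J"
    proof (cases "J' = J")
      case True
      then have "(i, i') \<in> same_component K J"
        using neq Max by (auto simp: f_def split: if_splits)
      then have "i = i'"
        using i i'(1) True same_component_sym[of i i' K J] by (auto simp: component_minima_def intro: order.antisym)
      then show ?thesis
        using True by simp
    next
      case False
      then show ?thesis
        using sub J fin by (meson psubsetI psubset_card_mono rev_finite_subset)
    qed
  qed
qed

lemma snd_hom_mult:
  assumes "\<theta> \<in> hom (RC V K) infinite_dihedral" "x \<in> carrier (RC V K)" "y \<in> carrier (RC V K)"
  shows "snd (\<theta> (x \<otimes>\<^bsub>RC V K\<^esub> y)) = snd (\<theta> x) * snd (\<theta> y)"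
  using hom_mult[OF assms] by (cases "\<theta> x"; cases "\<theta> y") simp

text \<open>Every element is a product of some \<open>h\<close> in the generated subgroup and some
  \<open>transversal A\<close>. For an element of the derived subgroup each generator has even
  parity, which forces \<open>A = {}\<close>.\<close>

lemma derived_RC: "derived (RC V K) (carrier (RC V K)) = generate (RC V K) basic_commutators"
proof
  let ?D = "derived (RC V K) (carrier (RC V K))"
  have D: "subgroup ?D (RC V K)"
    by (rule derived_is_subgroup) simp
  have "basic_commutators \<subseteq> ?D"
    using basic_commutator_in_derived by (auto simp: basic_commutators_def component_minima_def)
  then show sub: "generate (RC V K) basic_commutators \<subseteq> ?D"
    by (rule generate_subgroup_incl[OF _ D])
  show "?D \<subseteq> generate (RC V K) basic_commutators"
  proof
    fix x assume x: "x \<in> ?D"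
    let ?H = "generate (RC V K) basic_commutators"
    have Dc: "?D \<subseteq> carrier (RC V K)"
      by (rule derived_in_carrier) simp
    then have "subgroup ?H (RC V K)"
      using \<open>basic_commutators \<subseteq> ?D\<close> by (intro generate_is_subgroup) blast
    moreover have "x \<in> generate (RC V K) (RC_gen V K ` V)"
      using x Dc carrier_RC_generate[OF K] by blast
    ultimately obtain h A where hA: "h \<in> ?H" "A \<subseteq> V" "x = h \<otimes>\<^bsub>RC V K\<^esub> transversal A"
      using coset_transversal generate.incl by (metis subsetI)
    have "A = {}"
    proof (rule ccontr)
      assume "A \<noteq> {}"
      then obtain a where a: "a \<in> A"
        by blast
      \<comment> \<open>Reflecting only at \<open>a\<close> makes the sign of
        \<open>\<theta>\<close> the parity of the number of occurrences of
        \<open>g a\<close>.\<close>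
      obtain \<theta> where \<theta>: "\<theta> \<in> hom (RC V K) infinite_dihedral"
        "\<And>i. i \<in> V \<Longrightarrow> \<theta> (RC_gen V K i) = (if i \<in> {a} then (0, -1) else (0, 1))"
        using RC_dihedral_hom[of "{a}" "\<lambda>_. 0"] by metis
      have word: "snd (\<theta> (word_prod ks)) = (if a \<in> set ks then -1 else 1)"
        if "set ks \<subseteq> V" "distinct ks" for ks
        using that
      proof (induction ks)
        case Nil
        then show ?case
          using hom_one[OF \<theta>(1) is_group group_infinite_dihedral] by (simp add: one_infinite_dihedral)
      next
        case (Cons k ks)
        then show ?case
          using snd_hom_mult[OF \<theta>(1), of "RC_gen V K k" "word_prod ks"] \<theta>(2)[of k]
          by (auto simp: word_prod_closed)
      qed
      have "snd (\<theta> (transversal A)) = -1"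
        using word[of "sorted_list_of_set A"] hA(2) a finite_subset[OF hA(2) fin] by (simp add: transversal_def)
      moreover have "snd (\<theta> h) = 1" "snd (\<theta> x) = 1"
        using derived_infinite_dihedral[OF \<theta>(1) is_group] sub hA(1) x by auto
      moreover have "snd (\<theta> x) = snd (\<theta> h) * snd (\<theta> (transversal A))"
        unfolding hA(3) using hA sub Dc by (intro snd_hom_mult[OF \<theta>(1)]) auto
      ultimately show False
        by simp
    qed
    then show "x \<in> ?H"
      using hA sub Dc by auto
  qed
qed

text \<open>Each pair contributes one dihedral homomorphism and one basic commutator; the
  translation parts form a square matrix that is triangular with respect to the size of the vertex
  set.\<close>

lemma card_minima_pairs_le:
  assumes "generates (RC V K) (derived (RC V K) (carrier (RC V K))) T" "finite T"
  shows "card (minima_pairs V K) \<le> card T"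
proof -
  let ?D = "derived (RC V K) (carrier (RC V K))"
  have "\<forall>p\<in>minima_pairs V K. \<exists>\<theta>. \<theta> \<in> hom (RC V K) infinite_dihedral \<and>
      fst (\<theta> (case_prod basic_commutator p)) \<noteq> 0 \<and>
      (\<forall>q\<in>minima_pairs V K. fst (\<theta> (case_prod basic_commutator q)) \<noteq> 0 \<longrightarrow> q = p \<or> card (fst q) < card (fst p))"
  proof
    fix p assume p: "p \<in> minima_pairs V K"
    obtain J i where Ji: "p = (J, i)"
      by (cases p)
    show "\<exists>\<theta>. \<theta> \<in> hom (RC V K) infinite_dihedral \<and>
      fst (\<theta> (case_prod basic_commutator p)) \<noteq> 0 \<and>
      (\<forall>q\<in>minima_pairs V K. fst (\<theta> (case_prod basic_commutator q)) \<noteq> 0 \<longrightarrow> q = p \<or> card (fst q) < card (fst p))"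
    proof (rule triangular_dihedral_hom[OF p[unfolded Ji]])
      fix \<theta> assume \<theta>: "\<theta> \<in> hom (RC V K) infinite_dihedral" "fst (\<theta> (basic_commutator J i)) \<noteq> 0"
        "\<And>J' i'. (J', i') \<in> minima_pairs V K \<Longrightarrow> fst (\<theta> (basic_commutator J' i')) \<noteq> 0 \<Longrightarrow>
          (J', i') = (J, i) \<or> card J' < card J"
      have "q = p \<or> card (fst q) < card (fst p)"
        if "q \<in> minima_pairs V K" "fst (\<theta> (case_prod basic_commutator q)) \<noteq> 0" for q
        using that \<theta>(3)[of "fst q" "snd q"] by (simp add: Ji case_prod_beta)
      moreover have "fst (\<theta> (case_prod basic_commutator p)) \<noteq> 0"
        using \<theta>(2) Ji by simp
      ultimately show ?thesis
        using \<theta>(1) by blast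
    qed
  qed
  then obtain \<theta> where \<theta>: "\<And>p. p \<in> minima_pairs V K \<Longrightarrow> \<theta> p \<in> hom (RC V K) infinite_dihedral"
      "\<And>p. p \<in> minima_pairs V K \<Longrightarrow> fst (\<theta> p (case_prod basic_commutator p)) \<noteq> 0"
      "\<And>p q. p \<in> minima_pairs V K \<Longrightarrow> q \<in> minima_pairs V K \<Longrightarrow>
        fst (\<theta> p (case_prod basic_commutator q)) \<noteq> 0 \<Longrightarrow> q = p \<or> card (fst q) < card (fst p)"
    by metis
  have D: "subgroup ?D (RC V K)"
    by (rule derived_is_subgroup) simp
  show ?thesis
  proof (rule card_generating_set_ge[OF D assms, where \<phi> = "\<lambda>p x. fst (\<theta> p x)" and
        s = "case_prod basic_commutator" and r = "\<lambda>p. card (fst p)"])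
    fix p x y assume p: "p \<in> minima_pairs V K" and xy: "x \<in> ?D" "y \<in> ?D"
    have "x \<in> carrier (RC V K)" "y \<in> carrier (RC V K)"
      using xy subgroup.subset[OF D] by auto
    then show "fst (\<theta> p (x \<otimes>\<^bsub>RC V K\<^esub> y)) = fst (\<theta> p x) + fst (\<theta> p y)"
      using hom_mult[OF \<theta>(1)[OF p]] derived_infinite_dihedral[OF \<theta>(1)[OF p] is_group xy(1)]
      by (cases "\<theta> p x"; cases "\<theta> p y") simp
  qed (use \<theta> finite_minima_pairs[OF fin] basic_commutator_in_derived in
      \<open>auto simp: minima_pairs_def component_minima_def\<close>)
qed

text \<open>The lower bound is used three times: for the basic commutators themselves it shows that
  distinct pairs give distinct elements, for proper subsets it gives irredundancy, and for arbitrary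
  finite generating sets minimality.\<close>

lemma basic_commutators_minimal:
  "finite_minimal_generator_set (RC V K) (derived (RC V K) (carrier (RC V K))) basic_commutators"
  "card basic_commutators = card (minima_pairs V K)"
proof -
  let ?D = "derived (RC V K) (carrier (RC V K))"
  have image: "basic_commutators = case_prod basic_commutator ` minima_pairs V K"
    by (force simp: basic_commutators_def minima_pairs_def)
  then have finite: "finite basic_commutators"
    using finite_minima_pairs[OF fin] by simp
  have gen: "generates (RC V K) ?D basic_commutators"
    by (auto simp: generates_def derived_RC intro: generate.incl)
  have le: "card basic_commutators \<le> card (minima_pairs V K)"
    unfolding image by (rule card_image_le[OF finite_minima_pairs[OF fin]])
  then show "card basic_commutators = card (minima_pairs V K)"
    using card_minima_pairs_le[OF gen finite] by simp
  have "\<not> generates (RC V K) ?D T'" if "T' \<subset> basic_commutators" for T'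
    using card_minima_pairs_le[of T'] le psubset_card_mono[OF finite that] finite_subset[of T'] that finite
    by force
  then show "finite_minimal_generator_set (RC V K) ?D basic_commutators"
    unfolding finite_minimal_generator_set_def
    using finite gen card_minima_pairs_le le by (meson order.trans)
qed

end

section \<open>The rank of reduced homology in degree zero\<close>

lemma hom_finprod_int_pow:
  assumes "comm_group G" "\<tau> \<in> hom G integer_group" "finite D" "D \<subseteq> carrier G"
  shows "\<tau> (\<Otimes>\<^bsub>G\<^esub>b\<in>D. b [^]\<^bsub>G\<^esub> c b) = (\<Sum>b\<in>D. c b * \<tau> b)"
proof -
  interpret G: comm_group G by fact
  interpret \<tau>: group_hom G integer_group \<tau>
    using assms by (simp add: group_hom_def group_hom_axioms_def G.is_group)
  show ?thesis
    using assms(3,4)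
  proof (induction D rule: finite_induct)
    case empty
    then show ?case
      using \<tau>.hom_one by simp
  next
    case (insert d D)
    have "\<tau> (d [^]\<^bsub>G\<^esub> c d) = c d * \<tau> d"
      using insert.prems by (simp add: \<tau>.hom_int_pow)
    moreover have "(\<Otimes>\<^bsub>G\<^esub>b\<in>insert d D. b [^]\<^bsub>G\<^esub> c b) = d [^]\<^bsub>G\<^esub> c d \<otimes>\<^bsub>G\<^esub> (\<Otimes>\<^bsub>G\<^esub>b\<in>D. b [^]\<^bsub>G\<^esub> c b)"
      using insert.hyps insert.prems by (intro G.finprod_insert) auto
    moreover have "(\<Otimes>\<^bsub>G\<^esub>b\<in>D. b [^]\<^bsub>G\<^esub> c b) \<in> carrier G"
      using insert.prems by (intro G.finprod_closed) auto
    ultimately show ?case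
      using insert by simp
  qed
qed

text \<open>The \<open>\<sigma> i\<close> give integer coordinates on the quotient, so more than
  \<open>card M\<close> elements satisfy a nontrivial relation. The classes of the dual family
  \<open>e\<close> are independent and attain the bound.\<close>

lemma abelian_rank_FactGroup:
  fixes \<sigma> :: "'m \<Rightarrow> 'a \<Rightarrow> int"
  assumes G: "comm_group G" "subgroup B G" and M: "finite M"
    and hom: "\<And>i. i \<in> M \<Longrightarrow> \<sigma> i \<in> hom G integer_group"
    and B: "B = {z \<in> carrier G. \<forall>i\<in>M. \<sigma> i z = 0}"
    and e: "\<And>i. i \<in> M \<Longrightarrow> e i \<in> carrier G"
    and dual: "\<And>i j. i \<in> M \<Longrightarrow> j \<in> M \<Longrightarrow> \<sigma> i (e j) = (if i = j then 1 else 0)"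
  shows "abelian_rank (G Mod B) = enat (card M)"
proof -
  interpret G: comm_group G by fact
  interpret Q: comm_group "G Mod B"
    by (rule G.abelian_FactGroup[OF G(2)])
  have normal: "B \<lhd> G"
    by (rule G.subgroup_imp_normal[OF G(2)])
  have "\<exists>\<tau>. \<tau> \<in> hom (G Mod B) integer_group \<and> (\<forall>z\<in>carrier G. \<tau> (B #>\<^bsub>G\<^esub> z) = \<sigma> i z)" if i: "i \<in> M" for i
  proof -
    interpret \<sigma>: group_hom G integer_group "\<sigma> i"
      using hom[OF i] by (simp add: group_hom_def group_hom_axioms_def G.is_group)
    have "B \<subseteq> kernel G integer_group (\<sigma> i)"
      using i unfolding B by (auto simp: kernel_def)
    then show ?thesis
      using \<sigma>.FactGroup_universal_kernel[OF normal] by metis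
  qed
  then obtain \<tau> where \<tau>: "\<And>i. i \<in> M \<Longrightarrow> \<tau> i \<in> hom (G Mod B) integer_group"
    "\<And>i z. i \<in> M \<Longrightarrow> z \<in> carrier G \<Longrightarrow> \<tau> i (B #>\<^bsub>G\<^esub> z) = \<sigma> i z"
    by metis
  \<comment> \<open>The coordinates are jointly injective because \<open>B\<close> is exactly the
    common kernel of the \<open>\<sigma> i\<close>.\<close>
  have one: "q = \<one>\<^bsub>G Mod B\<^esub>" if q: "q \<in> carrier (G Mod B)" "\<And>i. i \<in> M \<Longrightarrow> \<tau> i q = 0" for q
  proof -
    obtain z where z: "z \<in> carrier G" "q = B #>\<^bsub>G\<^esub> z"
      using q(1) by (auto simp: carrier_FactGroup)
    then have "z \<in> B"
      using q(2) \<tau>(2) unfolding B by simp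
    then show ?thesis
      using z G.coset_join2[OF z(1) G(2)] by simp
  qed
  let ?S = "{D. finite D \<and> D \<subseteq> carrier (G Mod B) \<and> int_independent (G Mod B) D}"
  let ?e = "\<lambda>i. B #>\<^bsub>G\<^esub> e i"
  have "card D \<le> card M" if D: "D \<in> ?S" for D
  proof (rule ccontr)
    assume "\<not> card D \<le> card M"
    then obtain c where c: "\<exists>d\<in>D. c d \<noteq> 0" "\<And>i. i \<in> M \<Longrightarrow> (\<Sum>d\<in>D. c d * \<tau> i d) = 0"
      using homogeneous_system_nontrivial_solution[OF M, of D "\<lambda>d i. \<tau> i d"] D by auto
    have "(\<Otimes>\<^bsub>G Mod B\<^esub>b\<in>D. b [^]\<^bsub>G Mod B\<^esub> c b) = \<one>\<^bsub>G Mod B\<^esub>"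
    proof (rule one)
      show "(\<Otimes>\<^bsub>G Mod B\<^esub>b\<in>D. b [^]\<^bsub>G Mod B\<^esub> c b) \<in> carrier (G Mod B)"
        using D by (intro Q.finprod_closed) auto
      show "\<tau> i (\<Otimes>\<^bsub>G Mod B\<^esub>b\<in>D. b [^]\<^bsub>G Mod B\<^esub> c b) = 0" if "i \<in> M" for i
        using hom_finprod_int_pow[OF Q.comm_group_axioms \<tau>(1)[OF that], of D c] D c(2)[OF that] by simp
    qed
    then show False
      using D c(1) unfolding int_independent_def by blast
  qed
  moreover have "?e ` M \<in> ?S" and "card (?e ` M) = card M"
  proof -
    have inj: "inj_on ?e M"
      by (rule inj_onI) (metis \<tau>(2) dual e zero_neq_one)
    then show "card (?e ` M) = card M"
      by (rule card_image)
    have sub: "?e ` M \<subseteq> carrier (G Mod B)"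
      using e by (auto simp: carrier_FactGroup)
    have "c (?e i) = 0"
      if c: "(\<Otimes>\<^bsub>G Mod B\<^esub>b\<in>?e ` M. b [^]\<^bsub>G Mod B\<^esub> c b) = \<one>\<^bsub>G Mod B\<^esub>" and i: "i \<in> M" for c :: "'a set \<Rightarrow> int" and i
    proof -
      have "0 = \<tau> i (\<Otimes>\<^bsub>G Mod B\<^esub>b\<in>?e ` M. b [^]\<^bsub>G Mod B\<^esub> c b)"
        using hom_one[OF \<tau>(1)[OF i] Q.is_group group_integer_group] unfolding c by simp
      also have "\<dots> = (\<Sum>b\<in>?e ` M. c b * \<tau> i b)"
        using hom_finprod_int_pow[OF Q.comm_group_axioms \<tau>(1)[OF i]] M sub by simp
      also have "\<dots> = (\<Sum>j\<in>M. c (?e j) * \<tau> i (?e j))"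
        by (simp add: sum.reindex[OF inj])
      also have "\<dots> = (\<Sum>j\<in>M. if j = i then c (?e j) else 0)"
        by (rule sum.cong) (use i \<tau>(2) e dual in auto)
      also have "\<dots> = c (?e i)"
        using M i by simp
      finally show ?thesis
        by simp
    qed
    then show "?e ` M \<in> ?S"
      using M sub unfolding int_independent_def by blast
  qed
  ultimately show ?thesis
    unfolding abelian_rank_def
    by (intro antisym SUP_least SUP_upper2[of "?e ` M"]) auto
qed

text \<open>The augmentation restricted to the component of \<open>i\<close>; these are the
  functionals that detect reduced homology in degree zero.\<close>

definition component_sum :: "'i set set \<Rightarrow> 'i set \<Rightarrow> 'i \<Rightarrow> ('i set \<Rightarrow>\<^sub>0 int) \<Rightarrow> int" where
  "component_sum K J i z = (\<Sum>v\<in>{v \<in> J. (i, v) \<in> same_component K J}. poly_mapping.lookup z {v})"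

lemma simplicial_boundary_add: "simplicial_boundary (x + y) = simplicial_boundary x + simplicial_boundary y"
  by (simp add: simplicial_boundary_def frag_extend_add)

lemma simplicial_boundary_diff: "simplicial_boundary (x - y) = simplicial_boundary x - simplicial_boundary y"
  by (simp add: simplicial_boundary_def frag_extend_diff)

lemma simplicial_boundary_vertex: "simplicial_boundary (frag_of {v}) = frag_of {}"
proof -
  have empty: "{u \<in> {v}. u < v} = {}"
    by auto
  have "simplicial_boundary (frag_of {v}) = frag_cmul ((-1) ^ card {u \<in> {v}. u < v}) (frag_of {})"
    by (simp add: simplicial_boundary_def)
  then show ?thesis
    unfolding empty by simp
qed

lemma simplicial_boundary_edge:
  assumes "u < v"
  shows "simplicial_boundary (frag_of {u, v}) = frag_of {v} - frag_of {u}"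
proof -
  have sets: "{w \<in> {u, v}. w < u} = {}" "{w \<in> {u, v}. w < v} = {u}" "{u, v} - {u} = {v}" "{u, v} - {v} = {u}"
    using assms by auto
  have "simplicial_boundary (frag_of {u, v}) =
      frag_cmul ((-1) ^ card {w \<in> {u, v}. w < u}) (frag_of ({u, v} - {u})) +
      frag_cmul ((-1) ^ card {w \<in> {u, v}. w < v}) (frag_of ({u, v} - {v}))"
    using assms by (simp add: simplicial_boundary_def)
  then show ?thesis
    unfolding sets by simp
qed

lemma frag_cmul_diff_distrib2: "frag_cmul c (x - y) = frag_cmul c x - frag_cmul c y"
  by (rule poly_mapping_eqI) (simp add: lookup_minus right_diff_distrib)

lemma sum_frag_cmul: "(\<Sum>v\<in>A. frag_cmul (c v) x) = frag_cmul (\<Sum>v\<in>A. c v) x"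
  by (induction A rule: infinite_finite_induct) (simp_all add: frag_cmul_distrib)

section \<open>Cycles and boundaries of a full subcomplex in degree zero\<close>

context
  fixes V J :: "'i::linorder set" and K :: "'i set set"
  assumes K: "simplicial_complex_on V K" and J: "J \<subseteq> V" "finite J"
begin

abbreviation (input) "vertex_simplices \<equiv> (\<lambda>v. {v}) ` J"
abbreviation (input) "edges \<equiv> {I \<in> full_subcomplex K J. finite I \<and> card I = 2}"
abbreviation (input) "cycles0 \<equiv> {z. Poly_Mapping.keys z \<subseteq> vertex_simplices \<and> (\<Sum>v\<in>J. poly_mapping.lookup z {v}) = (0::int)}"
abbreviation (input) "boundaries0 \<equiv> simplicial_boundary ` {y. Poly_Mapping.keys y \<subseteq> edges}"

lemma chain_group_1: "simplicial_chain_group 1 (full_subcomplex K J) = free_Abelian_group vertex_simplices"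
proof -
  have "{I \<in> full_subcomplex K J. finite I \<and> card I = 1} = vertex_simplices"
    using K J by (auto simp: full_subcomplex_def simplicial_complex_on_def card_1_singleton_iff)
  then show ?thesis
    by (simp add: simplicial_chain_group_def)
qed

lemma component_sum_add_diff:
  "component_sum K J i (x + y) = component_sum K J i x + component_sum K J i y"
  "component_sum K J i (x - y) = component_sum K J i x - component_sum K J i y"
  by (simp_all add: component_sum_def lookup_add lookup_minus sum.distrib sum_subtractf)

lemma component_sum_vertex:
  "v \<in> J \<Longrightarrow> component_sum K J i (frag_of {v}) = (if (i, v) \<in> same_component K J then 1 else 0)"
  using J(2) by (simp add: component_sum_def when_def)

text \<open>On vertices the boundary is the augmentation with values in multiples of the empty
  simplex, whence the description of \<open>cycles0\<close> by a vanishing coefficient sum.\<close>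

lemma simplicial_boundary_vertices:
  assumes "Poly_Mapping.keys z \<subseteq> vertex_simplices"
  shows "simplicial_boundary z = frag_cmul (\<Sum>v\<in>J. poly_mapping.lookup z {v}) (frag_of {})"
  using assms
proof (induction z rule: free_Abelian_group_induct[consumes 1, case_names zero diff gen])
  case (diff x y)
  then show ?case
    by (simp add: simplicial_boundary_diff lookup_minus sum_subtractf frag_cmul_diff_distrib)
next
  case (gen a)
  then show ?case
    using J(2) by (auto simp: simplicial_boundary_vertex when_def)
qed (simp add: simplicial_boundary_def)

lemma vertex_cycles:
  "kernel (simplicial_chain_group 1 (full_subcomplex K J)) (simplicial_chain_group 0 (full_subcomplex K J))
     simplicial_boundary = cycles0"
proof -
  have "\<one>\<^bsub>simplicial_chain_group 0 (full_subcomplex K J)\<^esub> = 0"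
    by (simp add: simplicial_chain_group_def free_Abelian_group_def)
  then show ?thesis
    unfolding kernel_def chain_group_1 by (auto simp: simplicial_boundary_vertices)
qed

lemma subgroup_cycles: "subgroup cycles0 (free_Abelian_group vertex_simplices)"
proof
  fix x y :: "'i set \<Rightarrow>\<^sub>0 int" assume "x \<in> cycles0" "y \<in> cycles0"
  then show "x \<otimes>\<^bsub>free_Abelian_group vertex_simplices\<^esub> y \<in> cycles0"
    using keys_add[of x y] by (auto simp: lookup_add sum.distrib)
qed (auto simp: sum_negf)

lemma edge_boundary:
  assumes "I \<in> edges"
  obtains u v where "{u, v} \<in> full_subcomplex K J" "u \<in> J" "v \<in> J" "u < v"
    "I = {u, v}" "simplicial_boundary (frag_of I) = frag_of {v} - frag_of {u}"
proof -
  obtain x y where "I = {x, y}" "x \<noteq> y"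
    using assms by (auto simp: card_2_iff)
  then obtain u v where "I = {u, v}" "u < v"
    by (metis insert_commute neqE)
  then show thesis
    using that assms simplicial_boundary_edge by (auto simp: full_subcomplex_def)
qed

text \<open>The two ends of an edge lie in the same component and enter its boundary with opposite
  signs.\<close>

lemma boundaries_subset: "boundaries0 \<subseteq> {z \<in> cycles0. \<forall>i. component_sum K J i z = 0}"
proof (rule image_subsetI)
  fix y :: "'i set \<Rightarrow>\<^sub>0 int" assume "y \<in> {y. Poly_Mapping.keys y \<subseteq> edges}"
  then have "Poly_Mapping.keys y \<subseteq> edges"
    by simp
  then show "simplicial_boundary y \<in> {z \<in> cycles0. \<forall>i. component_sum K J i z = 0}"
  proof (induction y rule: free_Abelian_group_induct[consumes 1, case_names zero diff gen])
    case zero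
    then show ?case
      by (simp add: simplicial_boundary_def component_sum_def)
  next
    case (diff x y)
    then show ?case
      using keys_diff[of "simplicial_boundary x" "simplicial_boundary y"]
      by (auto simp: simplicial_boundary_diff component_sum_add_diff lookup_minus sum_subtractf)
  next
    case (gen I)
    then obtain u v where uv: "{u, v} \<in> full_subcomplex K J" "u \<in> J" "v \<in> J"
      "simplicial_boundary (frag_of I) = frag_of {v} - frag_of {u}"
      by (rule edge_boundary)
    have "(u, v) \<in> same_component K J"
      using uv(1) by (auto simp: same_component_def)
    then have "(i, u) \<in> same_component K J \<longleftrightarrow> (i, v) \<in> same_component K J" for i
      using same_component_trans same_component_sym by metis
    then show ?case
      unfolding uv(4) using uv(2,3) keys_diff[of "frag_of {v}" "frag_of {u}"] J(2)
      by (auto simp: component_sum_add_diff component_sum_vertex lookup_minus sum_subtractf when_def)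
  qed
qed

lemma boundaries_closed:
  "0 \<in> boundaries0"
  "x \<in> boundaries0 \<Longrightarrow> y \<in> boundaries0 \<Longrightarrow> x + y \<in> boundaries0"
  "x \<in> boundaries0 \<Longrightarrow> frag_cmul c x \<in> boundaries0"
proof -
  show "0 \<in> boundaries0"
    by (rule image_eqI[of _ _ 0]) (simp_all add: simplicial_boundary_def)
  show "x + y \<in> boundaries0" if "x \<in> boundaries0" "y \<in> boundaries0"
  proof -
    obtain a b where "x = simplicial_boundary a" "y = simplicial_boundary b"
      "Poly_Mapping.keys a \<subseteq> edges" "Poly_Mapping.keys b \<subseteq> edges"
      using \<open>x \<in> boundaries0\<close> \<open>y \<in> boundaries0\<close> by blast
    moreover have "Poly_Mapping.keys (a + b) \<subseteq> edges"
      using keys_add[of a b] calculation by blast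
    ultimately show ?thesis
      by (simp add: flip: simplicial_boundary_add)
  qed
  show "frag_cmul c x \<in> boundaries0" if "x \<in> boundaries0"
  proof -
    obtain a where "x = simplicial_boundary a" "Poly_Mapping.keys a \<subseteq> edges"
      using \<open>x \<in> boundaries0\<close> by blast
    moreover have "Poly_Mapping.keys (frag_cmul c a) \<subseteq> edges"
      using keys_cmul[of c a] calculation by blast
    moreover have "simplicial_boundary (frag_cmul c a) = frag_cmul c (simplicial_boundary a)"
      by (simp add: simplicial_boundary_def frag_extend_cmul)
    ultimately show ?thesis
      by (metis (mono_tags, lifting) image_eqI mem_Collect_eq)
  qed
qed

lemma boundaries_sum: "(\<And>v. v \<in> A \<Longrightarrow> x v \<in> boundaries0) \<Longrightarrow> (\<Sum>v\<in>A. x v) \<in> boundaries0"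
  by (induction A rule: infinite_finite_induct) (use boundaries_closed in auto)

text \<open>The boundaries of the edges of a path telescope. A step with \<open>v = w\<close> comes
  from a single vertex and contributes nothing; an edge traversed downwards contributes with a minus
  sign.\<close>

lemma same_component_boundary:
  assumes "(u, v) \<in> same_component K J"
  shows "frag_of {v} - frag_of {u} \<in> boundaries0"
  using assms unfolding same_component_def
proof (induction rule: rtrancl_induct)
  case base
  then show ?case
    using boundaries_closed(1) by simp
next
  case (step v w)
  have "frag_of {w} - frag_of {v} \<in> boundaries0"
  proof (cases "v = w")
    case True
    then show ?thesis
      using boundaries_closed(1) by simp
  next
    case False
    then have edge: "{v, w} \<in> edges"
      using step(2) by simp
    then have bd: "simplicial_boundary (frag_of {v, w}) \<in> boundaries0"
      by (intro imageI) simp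
    show ?thesis
    proof (cases "v < w")
      case True
      then show ?thesis
        using bd by (simp add: simplicial_boundary_edge)
    next
      case False
      then have "simplicial_boundary (frag_of {v, w}) = frag_of {v} - frag_of {w}"
        using \<open>v \<noteq> w\<close> simplicial_boundary_edge[of w v] by (simp add: insert_commute)
      then have eq: "frag_of {w} - frag_of {v} = frag_cmul (-1) (simplicial_boundary (frag_of {v, w}))"
        by simp
      show ?thesis
        unfolding eq by (rule boundaries_closed(3)[OF bd])
    qed
  qed
  from boundaries_closed(2)[OF step(3) this] show ?case
    by simp
qed

lemma vertex_chain_expansion:
  assumes "Poly_Mapping.keys z \<subseteq> vertex_simplices"
  shows "z = (\<Sum>v\<in>J. frag_cmul (poly_mapping.lookup z {v}) (frag_of {v}))"
  using assms
proof (induction z rule: free_Abelian_group_induct[consumes 1, case_names zero diff gen])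
  case (diff x y)
  then show ?case
    by (simp add: lookup_minus frag_cmul_diff_distrib sum_subtractf)
next
  case (gen a)
  then obtain u where u: "u \<in> J" "a = {u}"
    by blast
  have "(\<Sum>v\<in>J. frag_cmul (poly_mapping.lookup (frag_of {u}) {v}) (frag_of {v})) =
      (\<Sum>v\<in>J. if v = u then frag_of {u} else 0)"
    by (rule sum.cong) auto
  then show ?case
    using u J(2) by simp
qed simp

text \<open>Every vertex is moved to a component minimum or to \<open>Max J\<close>; the coefficients
  of the resulting chain are the component sums.\<close>

lemma cycle_boundary:
  assumes z: "z \<in> cycles0" and sums: "\<And>i. i \<in> component_minima K J \<Longrightarrow> component_sum K J i z = 0"
  shows "z \<in> boundaries0"
proof -
  let ?M = "component_minima K J"
  have "\<exists>r. r \<in> insert (Max J) ?M \<and> (r, v) \<in> same_component K J" if v: "v \<in> J" for v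
  proof (cases "(v, Max J) \<in> same_component K J")
    case True
    then show ?thesis
      by (intro exI[of _ "Max J"]) (simp add: same_component_sym)
  next
    case False
    then obtain r where "r \<in> ?M" "(r, v) \<in> same_component K J"
      by (rule component_minimum_exists[OF J(2) v])
    then show ?thesis
      by blast
  qed
  then obtain \<rho> where \<rho>: "\<And>v. v \<in> J \<Longrightarrow> \<rho> v \<in> insert (Max J) ?M"
    "\<And>v. v \<in> J \<Longrightarrow> (\<rho> v, v) \<in> same_component K J"
    by metis
  let ?z = "\<lambda>v. poly_mapping.lookup z {v}"
  \<comment> \<open>The representative of \<open>v\<close> is \<open>i\<close> exactly on the
    component of \<open>i\<close>, since a component has only one minimum and that of
    \<open>i\<close> avoids \<open>Max J\<close>.\<close>
  have fib: "{v \<in> J. \<rho> v = i} = {v \<in> J. (i, v) \<in> same_component K J}" if i: "i \<in> ?M" for i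
  proof -
    have "\<rho> v = i" if v: "v \<in> J" "(i, v) \<in> same_component K J" for v
    proof -
      have "(i, \<rho> v) \<in> same_component K J"
        using v \<rho>(2) same_component_sym same_component_trans by metis
      moreover have "\<rho> v \<noteq> Max J"
        using calculation i by (auto simp: component_minima_def)
      ultimately show ?thesis
        using i \<rho>(1)[OF v(1)] same_component_sym[of i "\<rho> v" K J]
        by (auto simp: component_minima_def intro: order.antisym)
    qed
    then show ?thesis
      using \<rho>(2) by auto
  qed
  have finM: "finite ?M"
    using J(2) by (simp add: component_minima_def)
  have MaxM: "Max J \<notin> ?M"
    by (simp add: component_minima_def)
  have zero: "(\<Sum>v\<in>{v \<in> J. \<rho> v = i}. ?z v) = 0" if "i \<in> ?M" for i
    using sums[OF that] unfolding component_sum_def fib[OF that] .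
  have "(\<Sum>i\<in>insert (Max J) ?M. \<Sum>v\<in>{v \<in> J. \<rho> v = i}. ?z v) = (\<Sum>v\<in>J. ?z v)"
    by (rule sum.group) (use J(2) finM \<rho>(1) in auto)
  \<comment> \<open>No component sum is assumed to vanish on the component of \<open>Max J\<close>;
    here the total coefficient sum of the cycle does the work.\<close>
  then have zero_Max: "(\<Sum>v\<in>{v \<in> J. \<rho> v = Max J}. ?z v) = 0"
    using finM MaxM zero z by simp
  have "(\<Sum>v\<in>J. frag_cmul (?z v) (frag_of {\<rho> v})) =
      (\<Sum>i\<in>insert (Max J) ?M. \<Sum>v\<in>{v \<in> J. \<rho> v = i}. frag_cmul (?z v) (frag_of {\<rho> v}))"
    by (rule sum.group[symmetric]) (use J(2) finM \<rho>(1) in auto)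
  also have "\<dots> = (\<Sum>i\<in>insert (Max J) ?M. frag_cmul (\<Sum>v\<in>{v \<in> J. \<rho> v = i}. ?z v) (frag_of {i}))"
    by (intro sum.cong refl) (simp flip: sum_frag_cmul)
  also have "\<dots> = 0"
    using zero zero_Max by (intro sum.neutral) auto
  finally have "(\<Sum>v\<in>J. frag_cmul (?z v) (frag_of {v} - frag_of {\<rho> v})) =
      (\<Sum>v\<in>J. frag_cmul (?z v) (frag_of {v}))"
    by (simp add: frag_cmul_diff_distrib2 sum_subtractf)
  also have "\<dots> = z"
    using vertex_chain_expansion z by simp
  finally have "z = (\<Sum>v\<in>J. frag_cmul (?z v) (frag_of {v} - frag_of {\<rho> v}))" ..
  also have "\<dots> \<in> boundaries0"
    by (intro boundaries_sum boundaries_closed(3) same_component_boundary \<rho>(2))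
  finally show ?thesis .
qed

lemma abelian_rank_reduced_homology_0:
  "abelian_rank (reduced_homology_group 0 (full_subcomplex K J)) = enat (card (component_minima K J))"
proof -
  let ?C = "free_Abelian_group vertex_simplices" and ?M = "component_minima K J"
  let ?Z = "subgroup_generated ?C cycles0"
  interpret C: comm_group ?C
    by (rule abelian_free_Abelian_group)
  have eq: "reduced_homology_group 0 (full_subcomplex K J) = ?Z Mod boundaries0"
  proof -
    have "carrier (simplicial_chain_group 2 (full_subcomplex K J)) = {y. Poly_Mapping.keys y \<subseteq> edges}"
      by (auto simp: simplicial_chain_group_def)
    then show ?thesis
      using vertex_cycles chain_group_1 by (simp add: reduced_homology_group_def numeral_2_eq_2)
  qed
  have carrier: "carrier ?Z = cycles0"
    by (rule subgroup.carrier_subgroup_generated_subgroup[OF subgroup_cycles])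
  have Z: "comm_group ?Z"
    by (rule C.abelian_subgroup_generated[OF C.comm_group_axioms])
  show ?thesis
    unfolding eq
  \<comment> \<open>Subtracting the vertex \<open>Max J\<close> turns \<open>{i}\<close> into a
    cycle and leaves the component sums at minima unchanged, because none of their components
    contains \<open>Max J\<close>.\<close>
  proof (rule abelian_rank_FactGroup[OF Z, where \<sigma> = "component_sum K J" and e = "\<lambda>i. frag_of {i} - frag_of {Max J}"])
    show "boundaries0 = {z \<in> carrier ?Z. \<forall>i\<in>?M. component_sum K J i z = 0}"
      unfolding carrier using boundaries_subset cycle_boundary by auto
    show "component_sum K J i \<in> hom ?Z integer_group" for i
      by (auto simp: hom_def component_sum_add_diff)
    show "finite ?M"
      using J(2) by (simp add: component_minima_def)
    have inJ: "i \<in> J" "Max J \<in> J" if "i \<in> ?M" for i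
      using that Max_in[OF J(2)] by (auto simp: component_minima_def)
    show "frag_of {i} - frag_of {Max J} \<in> carrier ?Z" if "i \<in> ?M" for i
      unfolding carrier using inJ[OF that] keys_diff[of "frag_of {i}" "frag_of {Max J}"] J(2)
      by (auto simp: lookup_minus sum_subtractf when_def)
    show "component_sum K J i (frag_of {j} - frag_of {Max J}) = (if i = j then 1 else 0)"
      if ij: "i \<in> ?M" "j \<in> ?M" for i j
    proof -
      have "(i, j) \<in> same_component K J \<longleftrightarrow> i = j"
        using ij same_component_sym[of i j K J]
        by (auto simp: component_minima_def intro: order.antisym)
      moreover have "(i, Max J) \<notin> same_component K J"
        using ij(1) by (simp add: component_minima_def)
      ultimately show ?thesis
        using inJ[OF ij(2)] by (simp add: component_sum_add_diff component_sum_vertex)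
    qed
    have "subgroup boundaries0 ?C"
    proof
      show "boundaries0 \<subseteq> carrier ?C"
        by (rule order_trans[OF boundaries_subset]) auto
      show "inv\<^bsub>?C\<^esub> x \<in> boundaries0" if "x \<in> boundaries0" for x
      proof -
        have "Poly_Mapping.keys x \<subseteq> vertex_simplices"
          using boundaries_subset that by blast
        then show ?thesis
          using boundaries_closed(3)[OF that, of "-1"] by simp
      qed
    qed (use boundaries_closed in simp_all)
    then show "subgroup boundaries0 ?Z"
      using boundaries_subset by (intro C.subgroup_of_subgroup_generated) auto
  qed
qed

end

section \<open>Iterated commutators indexed by vertex sets\<close>

lemma ex_component_iff:
  assumes K: "simplicial_complex_on V K" and J: "J \<subseteq> V" "i \<in> J" "j \<in> J"
  shows "(\<exists>C\<in>connected_components (full_subcomplex K J). j \<notin> C \<and> i \<in> C \<and> (\<forall>v\<in>C. i \<le> v)) \<longleftrightarrow>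
    (i, j) \<notin> same_component K J \<and> (\<forall>v. (i, v) \<in> same_component K J \<longrightarrow> i \<le> v)"
    (is "?L \<longleftrightarrow> ?R")
proof -
  \<comment> \<open>Every vertex of \<open>J\<close> is itself a simplex, so the components cover
    all of \<open>J\<close> and are the classes of \<open>same_component\<close> cut down to
    \<open>J\<close>.\<close>
  have "\<Union>(full_subcomplex K J) = J"
    using K J(1) by (auto simp: full_subcomplex_def simplicial_complex_on_def)
  then have comps: "connected_components (full_subcomplex K J) =
      (\<lambda>x. {v \<in> J. (x, v) \<in> same_component K J}) ` J"
    unfolding connected_components_def same_component_def[symmetric] quotient_def by auto
  show ?thesis
  proof
    assume ?L
    then obtain x where x: "(x, j) \<notin> same_component K J" "(x, i) \<in> same_component K J"
      "\<And>v. v \<in> J \<Longrightarrow> (x, v) \<in> same_component K J \<Longrightarrow> i \<le> v"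
      unfolding comps using J(3) by auto
    have "(x, v) \<in> same_component K J" if "(i, v) \<in> same_component K J" for v
      using same_component_trans[OF x(2) that] .
    then show ?R
      using x(1,3) same_component_in[OF _ J(2)] by blast
  next
    assume ?R
    then show ?L
      unfolding comps using J(2) by (intro bexI[of _ "{v \<in> J. (i, v) \<in> same_component K J}"]) auto
  qed
qed

text \<open>From pairs to lists, the length bound comes from \<open>card J \<le> card V\<close>.
  Conversely, sortedness and \<open>i < j\<close> make \<open>j\<close> the maximum of the vertex
  set, and \<open>ks\<close> is recovered by sorting the remaining vertices.\<close>

lemma (in involution_system) basic_commutators_eq:
  "basic_commutators = {iterated_commutator G g ks j i | ks j i.
     length ks + 2 \<le> card V \<and> set ks \<union> {j, i} \<subseteq> V \<and>
     sorted_wrt (<) (ks @ [j]) \<and> i < j \<and> i \<notin> set ks \<and>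
     (\<exists>C \<in> connected_components (full_subcomplex K (set ks \<union> {j, i})).
        j \<notin> C \<and> i \<in> C \<and> (\<forall>v\<in>C. i \<le> v))}" (is "_ = ?S")
proof
  show "basic_commutators \<subseteq> ?S"
  proof
    fix x assume "x \<in> basic_commutators"
    then obtain J i where J: "J \<subseteq> V" and i: "i \<in> component_minima K J" and x: "x = basic_commutator J i"
      by (auto simp: basic_commutators_def)
    let ?j = "Max J" and ?ks = "sorted_list_of_set (J - {i, Max J})"
    have fin: "finite J"
      using J finite_V finite_subset by blast
    have iJ: "i \<in> J" and less: "i < ?j"
      using i component_minima_less_Max[OF fin] by (auto simp: component_minima_def)
    have jJ: "?j \<in> J"
      using Max_in[OF fin] iJ by blast
    have ks: "set ?ks = J - {i, ?j}" "set ?ks \<union> {?j, i} = J"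
      using fin iJ jJ by auto
    have "length ?ks + 2 = card J"
    proof -
      have "card J = card (J - {i, ?j}) + card {i, ?j}"
        using card_Diff_subset[of "{i, ?j}" J] card_mono[OF fin, of "{i, ?j}"] iJ jJ by simp
      then show ?thesis
        using less by simp
    qed
    moreover have "card J \<le> card V"
      using card_mono[OF finite_V J] .
    moreover have "sorted_wrt (<) (?ks @ [?j])"
      using ks(1) Max_ge[OF fin] by (force simp: sorted_wrt_append order.order_iff_strict)
    moreover have "\<exists>C \<in> connected_components (full_subcomplex K J). ?j \<notin> C \<and> i \<in> C \<and> (\<forall>v\<in>C. i \<le> v)"
      using ex_component_iff[OF complex J iJ jJ] i by (simp add: component_minima_def)
    ultimately show "x \<in> ?S"
      unfolding x basic_commutator_def mem_Collect_eq using J less ks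
      by (intro exI[of _ ?ks] exI[of _ ?j] exI[of _ i]) simp
  qed
  show "?S \<subseteq> basic_commutators"
  proof clarify
    fix ks j i C
    assume V: "set ks \<union> {j, i} \<subseteq> V" and sorted: "sorted_wrt (<) (ks @ [j])" and i: "i < j" "i \<notin> set ks"
      and C: "C \<in> connected_components (full_subcomplex K (set ks \<union> {j, i}))" "j \<notin> C" "i \<in> C" "\<forall>v\<in>C. i \<le> v"
    let ?J = "set ks \<union> {j, i}"
    have Max: "Max ?J = j"
      using sorted i by (intro Max_eqI) (auto simp: sorted_wrt_append)
    have "?J - {i, Max ?J} = set ks"
      using sorted i unfolding Max by (auto simp: sorted_wrt_append)
    moreover have "sorted_wrt (<) ks"
      using sorted by (simp add: sorted_wrt_append)
    ultimately have "iterated_commutator G g ks j i = basic_commutator ?J i"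
      unfolding basic_commutator_def by (simp only: Max sorted_list_of_set_set)
    moreover have "i \<in> component_minima K ?J"
      using ex_component_iff[OF complex V, of i j] C Max by (auto simp: component_minima_def)
    ultimately show "iterated_commutator G g ks j i \<in> basic_commutators"
      using V unfolding basic_commutators_def by blast
  qed
qed

theorem theorem4p5:
  fixes m :: nat and K :: "nat set set"
  assumes "simplicial_complex_on {1..m} K"
  shows
    "let G = RC {1..m} K;
         g = RC_gen {1..m} K;
         S = {iterated_commutator G g ks j i | ks j i.
                length ks + 2 \<le> m \<and>
                set ks \<union> {j, i} \<subseteq> {1..m} \<and>
                sorted_wrt (<) (ks @ [j]) \<and> i < j \<and> i \<notin> set ks \<and>
                (\<exists>C \<in> connected_components (full_subcomplex K (set ks \<union> {j, i})).
                   j \<notin> C \<and> i \<in> C \<and> (\<forall>v\<in>C. i \<le> v))}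
     in finite_minimal_generator_set G (derived G (carrier G)) S \<and>
        enat (card S) =
          (\<Sum>J\<in>Pow {1..m}. abelian_rank (reduced_homology_group 0 (full_subcomplex K J)))"
proof -
  let ?V = "{1..m}"
  interpret involution_system "RC ?V K" "RC_gen ?V K" ?V K
    using involution_system_RC[OF assms] by simp
  have "(\<Sum>J\<in>Pow ?V. abelian_rank (reduced_homology_group 0 (full_subcomplex K J))) =
      (\<Sum>J\<in>Pow ?V. enat (card (component_minima K J)))"
  proof (rule sum.cong[OF refl], rule abelian_rank_reduced_homology_0[OF assms])
    fix J assume "J \<in> Pow ?V"
    then show "J \<subseteq> ?V" "finite J"
      using finite_subset by auto
  qed
  also have "\<dots> = enat (\<Sum>J\<in>Pow ?V. card (component_minima K J))"
    by (simp flip: of_nat_eq_enat)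
  also have "(\<Sum>J\<in>Pow ?V. card (component_minima K J)) = card (minima_pairs ?V K)"
    unfolding minima_pairs_def
    by (rule card_SigmaI[symmetric]) (auto simp: component_minima_def intro: finite_subset)
  finally have "(\<Sum>J\<in>Pow ?V. abelian_rank (reduced_homology_group 0 (full_subcomplex K J))) =
      enat (card basic_commutators)"
    using basic_commutators_minimal(2)[OF assms] by simp
  then show ?thesis
    using basic_commutators_minimal(1)[OF assms] basic_commutators_eq by (simp add: Let_def)
qed

end
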